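(* Let $\mathcal{O}\subset\mathcal{Y}$ be an open submanifold that is split as $\mathcal{O}=\mathbb{R}\times\check{\mathcal{O}}$, the coordinate on the first factor being $y_1$. Suppose that for all $y\in\mathcal{O}$ $$L_{h_2}L_{h_1}^i y_1=0,\quad i=0,\ldots,n-2,\qquad\text{and}\qquad L_{h_2}L_{h_1}^{n-1}y_1\neq 0 .$$ Then the smooth change of coordinates $s=S(y)$, where $S\in C^1(\mathcal{O},\mathbb{R}^n)$ is $$S(y)=\mathrm{col}\left(L_{h_1}^0y_1,\ldots,L_{h_1}^{n-1}y_1\right),$$ and the nonsingular feedback transformation $v=F(y)u$, where $F\in C(\mathcal{O},GL(2))$ is $$F(y)=\begin{pmatrix}1&0\\ L_{h_1}^n y_1 & L_{h_2}L_{h_1}^{n-1}y_1\end{pmatrix},$$ transform the system $$\dot x_1=u_1\cos y_1,\quad \dot x_2=u_1\sin y_1,\quad \dot y=u_1h_1(y)+u_2h_2(y)\qquad(\ast)$$ into the system $$\dot x_1=v_1\cos s_1,\quad \dot x_2=v_1\sin s_1,\quad \dot s_i=v_1s_{i+1}\ (i=1,\ldots,n-1),\quad \dot s_n=v_2 .$$ If, in addition, $S$ maps $\mathcal{O}$ bijectively onto $\mathbb{R}^n$, then the system $(\ast)$ is maneuverable on the manifold $\mathcal{M}=\mathbb{R}^2\times\mathcal{O}$.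
   Context: Let $n\ge 1$, let $\mathcal{Y}$ be a smooth $n$-dimensional manifold with coordinates $y=\mathrm{col}(y_1,\ldots,y_n)$, and let $h_1,h_2$ be vector fields on $\mathcal{Y}$, smooth enough for all Lie derivatives occurring to be defined and continuously differentiable as needed. The control system $(\ast)$ has state $q=\mathrm{col}(x,y)\in\mathcal{K}=\mathbb{R}^2\times\mathcal{Y}$, $x=\mathrm{col}(x_1,x_2)$, and input $u=\mathrm{col}(u_1,u_2)\in\mathbb{R}^2$. $L_h\phi$ is the Lie derivative of a function $\phi$ along a vector field $h$; $L_h^0\phi=\phi$, $L_h^i\phi=L_hL_h^{i-1}\phi$; $y_1$ is regarded as a function on $\mathcal{O}$. "Transform" means: $S$ has nonsingular Jacobian everywhere on $\mathcal{O}$ and, for $y(\cdot)$ with values in $\mathcal{O}$, the triple $(x,y,u)$ satisfies $(\ast)$ if and only if $(x,s,v)=(x,S(y),F(y)u)$ satisfies the second system. A trajectory $x^D:[0,\infty)\to\mathbb{R}^2$ is called admissible if $x^D\in C^{n+1}([0,\infty),\mathbb{R}^2)$ and $\inf_{t\ge0}|\dot x^D(t)|>0$. The system $(\ast)$ is called maneuverable on an open submanifold $\mathcal{M}\subset\mathcal{K}$ if for any admissible trajectory $x^D$ there exist $q^D=\mathrm{col}(x^D,y^D)\in C^1([0,\infty),\mathcal{M})$ and $u^D\in C([0,\infty),\mathbb{R}^2)$ that satisfy $(\ast)$. *)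

theory Defs
  imports "HOL-Analysis.Analysis"
begin

text \<open>Meant for open sets \<open>U\<close>: \<open>frechet_derivative f (at x)\<close> is the full derivative at \<open>x\<close>.\<close>

primrec Ck_on :: "nat \<Rightarrow> ('a::euclidean_space \<Rightarrow> 'b::real_normed_vector) \<Rightarrow> 'a set \<Rightarrow> bool" where
  "Ck_on 0 f U \<longleftrightarrow> continuous_on U f"
| "Ck_on (Suc k) f U \<longleftrightarrow>
     (\<forall>x\<in>U. f differentiable (at x)) \<and> (\<forall>v. Ck_on k (\<lambda>x. frechet_derivative f (at x) v) U)"

definition smooth_on :: "('a::euclidean_space \<Rightarrow> 'b::real_normed_vector) \<Rightarrow> 'a set \<Rightarrow> bool" where
  "smooth_on f U \<longleftrightarrow> (\<forall>k. Ck_on k f U)"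

text \<open>Curves on an interval \<open>I\<close>; derivatives are one-sided at end points belonging to \<open>I\<close>.\<close>

primrec Ck_curve_on :: "nat \<Rightarrow> (real \<Rightarrow> 'b::real_normed_vector) \<Rightarrow> real set \<Rightarrow> bool" where
  "Ck_curve_on 0 f I \<longleftrightarrow> continuous_on I f"
| "Ck_curve_on (Suc k) f I \<longleftrightarrow>
     (\<exists>f'. (\<forall>t\<in>I. (f has_vector_derivative f' t) (at t within I)) \<and> Ck_curve_on k f' I)"

text \<open>
  A chart is a pair \<open>(U, \<phi>)\<close> of an open set and a homeomorphism from it onto an open subset of
  \<open>real ^ 'n\<close>; the values of \<open>\<phi>\<close> outside \<open>U\<close> are irrelevant. The dimension is \<open>CARD('n)\<close>. The
  Hausdorff property and second countability are supplied by the type class of the points.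
\<close>

type_synonym ('m, 'n) chart = "'m set \<times> ('m \<Rightarrow> real ^ 'n)"

definition chart_inv :: "('m, 'n) chart \<Rightarrow> real ^ 'n \<Rightarrow> 'm" where
  "chart_inv c = inv_into (fst c) (snd c)"

definition is_chart :: "('m::topological_space, 'n::finite) chart \<Rightarrow> bool" where
  "is_chart c \<longleftrightarrow> open (fst c) \<and> open (snd c ` fst c) \<and> inj_on (snd c) (fst c) \<and>
     homeomorphism (fst c) (snd c ` fst c) (snd c) (chart_inv c)"

definition smoothly_compatible ::
    "('m::topological_space, 'n::finite) chart \<Rightarrow> ('m, 'n) chart \<Rightarrow> bool" where
  "smoothly_compatible c d \<longleftrightarrow>
     smooth_on (snd d \<circ> chart_inv c) (snd c ` (fst c \<inter> fst d)) \<and>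
     smooth_on (snd c \<circ> chart_inv d) (snd d ` (fst c \<inter> fst d))"

definition smooth_manifold ::
    "'m::{t2_space, second_countable_topology} set \<Rightarrow> ('m, 'n::finite) chart set \<Rightarrow> bool" where
  "smooth_manifold Y A \<longleftrightarrow>
     (\<forall>c\<in>A. is_chart c) \<and> \<Union>(fst ` A) = Y \<and> (\<forall>c\<in>A. \<forall>d\<in>A. smoothly_compatible c d)"

definition Ck_on_manifold ::
    "('m, 'n::finite) chart set \<Rightarrow> nat \<Rightarrow> ('m \<Rightarrow> 'b::real_normed_vector) \<Rightarrow> 'm set \<Rightarrow> bool" where
  "Ck_on_manifold A k f D \<longleftrightarrow>
     (\<forall>c\<in>A. Ck_on k (f \<circ> chart_inv c) (snd c ` (fst c \<inter> D)))"

definition nonsingular_jacobian_on ::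
    "('m, 'n::finite) chart set \<Rightarrow> ('m \<Rightarrow> real ^ 'n) \<Rightarrow> 'm set \<Rightarrow> bool" where
  "nonsingular_jacobian_on A S D \<longleftrightarrow>
     (\<forall>c\<in>A. \<forall>p \<in> fst c \<inter> D. det (jacobian (S \<circ> chart_inv c) (at (snd c p))) \<noteq> 0)"

text \<open>
  The splitting of an open submanifold \<open>D\<close> as a smooth product of the real line and a manifold \<open>Q\<close>
  of dimension one less: \<open>y1\<close> and \<open>z\<close> are the projections onto the two factors. The smooth structure
  of \<open>Q\<close> is encoded by the product charts \<open>id \<times> \<psi>\<close> with \<open>\<psi>\<close> a chart on \<open>V \<subseteq> Q\<close>: component \<open>k\<close> of
  the product chart is the first coordinate \<open>y1\<close> and the remaining \<open>CARD('n) - 1\<close> components are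
  the coordinates on \<open>V\<close> (component \<open>k\<close> of \<open>\<psi>\<close> is not used).
\<close>

definition splits_as_line_times ::
    "('m::topological_space, 'n::finite) chart set \<Rightarrow> 'm set \<Rightarrow> 'n \<Rightarrow> ('m \<Rightarrow> real) \<Rightarrow>
     ('m \<Rightarrow> 'q::topological_space) \<Rightarrow> 'q set \<Rightarrow> bool" where
  "splits_as_line_times A D k y1 z Q \<longleftrightarrow>
     (\<exists>g. homeomorphism D (UNIV \<times> Q) (\<lambda>p. (y1 p, z p)) g) \<and>
     (\<forall>q\<in>Q. \<exists>V (\<psi> :: 'q \<Rightarrow> real ^ 'n).
        openin (top_of_set Q) V \<and> q \<in> V \<and>
        (let c = ({p \<in> D. z p \<in> V}, \<lambda>p. \<chi> j. if j = k then y1 p else \<psi> (z p) $ j)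
         in is_chart c \<and> (\<forall>d\<in>A. smoothly_compatible c d)))"

text \<open>
  A vector field is given by its components \<open>h c p\<close> at \<open>p\<close> with respect to each chart \<open>c\<close> around \<open>p\<close>,
  subject to the transformation law of tangent vectors.
\<close>

type_synonym ('m, 'n) vfield = "('m, 'n) chart \<Rightarrow> 'm \<Rightarrow> real ^ 'n"

definition Ck_vector_field :: "('m, 'n::finite) chart set \<Rightarrow> nat \<Rightarrow> ('m, 'n) vfield \<Rightarrow> bool" where
  "Ck_vector_field A k h \<longleftrightarrow>
     (\<forall>c\<in>A. \<forall>d\<in>A. \<forall>p \<in> fst c \<inter> fst d.
        h d p = frechet_derivative (snd d \<circ> chart_inv c) (at (snd c p)) (h c p)) \<and>
     (\<forall>c\<in>A. Ck_on k (h c \<circ> chart_inv c) (snd c ` fst c))"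

text \<open>By the transformation law, the choice of the chart around \<open>p\<close> does not matter.\<close>

definition lie_derivative ::
    "('m, 'n::finite) chart set \<Rightarrow> ('m, 'n) vfield \<Rightarrow> ('m \<Rightarrow> real) \<Rightarrow> 'm \<Rightarrow> real" where
  "lie_derivative A h f p =
     (let c = (SOME c. c \<in> A \<and> p \<in> fst c)
      in frechet_derivative (f \<circ> chart_inv c) (at (snd c p)) (h c p))"

definition C1_curve_in :: "('m::topological_space, 'n::finite) chart set \<Rightarrow> (real \<Rightarrow> 'm) \<Rightarrow> real set \<Rightarrow> bool"
  where
  "C1_curve_in A y I \<longleftrightarrow> y ` I \<subseteq> \<Union>(fst ` A) \<and> continuous_on I y \<and>
     (\<forall>c\<in>A. \<exists>w. continuous_on {t \<in> I. y t \<in> fst c} w \<and>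
        (\<forall>t\<in>I. y t \<in> fst c \<longrightarrow> ((snd c \<circ> y) has_vector_derivative w t) (at t within I)))"

text \<open>
  \<open>w c\<close> are the components of the velocity in the chart \<open>c\<close>. Continuity at \<open>t\<close> ensures that near \<open>t\<close>
  the curve stays in the domain of \<open>c\<close>.
\<close>

definition has_velocity ::
    "('m::topological_space, 'n::finite) chart set \<Rightarrow> (real \<Rightarrow> 'm) \<Rightarrow>
     (('m, 'n) chart \<Rightarrow> real ^ 'n) \<Rightarrow> real \<Rightarrow> real set \<Rightarrow> bool" where
  "has_velocity A y w t I \<longleftrightarrow> y t \<in> \<Union>(fst ` A) \<and> continuous (at t within I) y \<and>
     (\<forall>c\<in>A. y t \<in> fst c \<longrightarrow> ((snd c \<circ> y) has_vector_derivative w c) (at t within I))"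

definition solves_system ::
    "('m::topological_space, 'n::finite) chart set \<Rightarrow> ('m \<Rightarrow> real) \<Rightarrow> ('m, 'n) vfield \<Rightarrow> ('m, 'n) vfield \<Rightarrow>
     real set \<Rightarrow> (real \<Rightarrow> real ^ 2) \<Rightarrow> (real \<Rightarrow> 'm) \<Rightarrow> (real \<Rightarrow> real ^ 2) \<Rightarrow> bool" where
  "solves_system A y1 h1 h2 I x y u \<longleftrightarrow>
     (\<forall>t\<in>I.
        ((\<lambda>t. x t $ 1) has_real_derivative u t $ 1 * cos (y1 (y t))) (at t within I) \<and>
        ((\<lambda>t. x t $ 2) has_real_derivative u t $ 1 * sin (y1 (y t))) (at t within I) \<and>
        has_velocity A y (\<lambda>c. u t $ 1 *\<^sub>R h1 c (y t) + u t $ 2 *\<^sub>R h2 c (y t)) t I)"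

text \<open>Here and below, \<open>e\<close> enumerates the index type: \<open>s $ e i\<close> is the component \<open>s\<^sub>i\<close>, \<open>1 \<le> i \<le> n\<close>.\<close>

definition solves_chained_system ::
    "(nat \<Rightarrow> 'n::finite) \<Rightarrow> real set \<Rightarrow> (real \<Rightarrow> real ^ 2) \<Rightarrow> (real \<Rightarrow> real ^ 'n) \<Rightarrow>
     (real \<Rightarrow> real ^ 2) \<Rightarrow> bool" where
  "solves_chained_system e I x s v \<longleftrightarrow>
     (\<forall>t\<in>I.
        ((\<lambda>t. x t $ 1) has_real_derivative v t $ 1 * cos (s t $ e 1)) (at t within I) \<and>
        ((\<lambda>t. x t $ 2) has_real_derivative v t $ 1 * sin (s t $ e 1)) (at t within I) \<and>
        (\<forall>i\<in>{1..<CARD('n)}.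
           ((\<lambda>t. s t $ e i) has_real_derivative v t $ 1 * s t $ e (i + 1)) (at t within I)) \<and>
        ((\<lambda>t. s t $ e CARD('n)) has_real_derivative v t $ 2) (at t within I))"

definition coord_change ::
    "('m, 'n::finite) chart set \<Rightarrow> (nat \<Rightarrow> 'n) \<Rightarrow> ('m \<Rightarrow> real) \<Rightarrow> ('m, 'n) vfield \<Rightarrow> 'm \<Rightarrow> real ^ 'n" where
  "coord_change A e y1 h1 p =
     (\<chi> j. (lie_derivative A h1 ^^ (inv_into {1..CARD('n)} e j - 1)) y1 p)"

definition feedback_matrix ::
    "('m, 'n::finite) chart set \<Rightarrow> ('m \<Rightarrow> real) \<Rightarrow> ('m, 'n) vfield \<Rightarrow> ('m, 'n) vfield \<Rightarrow> 'm \<Rightarrow> real ^ 2 ^ 2"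
  where
  "feedback_matrix A y1 h1 h2 p =
     vector [vector [1, 0],
             vector [(lie_derivative A h1 ^^ CARD('n)) y1 p,
                     lie_derivative A h2 ((lie_derivative A h1 ^^ (CARD('n) - 1)) y1) p]]"

definition admissible :: "nat \<Rightarrow> (real \<Rightarrow> real ^ 2) \<Rightarrow> bool" where
  "admissible n x \<longleftrightarrow> Ck_curve_on (n + 1) x {0..} \<and>
     (INF t\<in>{0..}. norm (vector_derivative x (at t within {0..}))) > 0"

definition maneuverable ::
    "('m::topological_space, 'n::finite) chart set \<Rightarrow> ('m \<Rightarrow> real) \<Rightarrow> ('m, 'n) vfield \<Rightarrow> ('m, 'n) vfield \<Rightarrow>
     ((real ^ 2) \<times> 'm) set \<Rightarrow> bool" where
  "maneuverable A y1 h1 h2 M \<longleftrightarrow>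
     (\<forall>xD. admissible CARD('n) xD \<longrightarrow>
        (\<exists>yD uD. Ck_curve_on 1 xD {0..} \<and> C1_curve_in A yD {0..} \<and>
           (\<forall>t\<ge>0. (xD t, yD t) \<in> M) \<and> continuous_on {0..} uD \<and>
           solves_system A y1 h1 h2 {0..} xD yD uD))"

end

theory Submission
  imports Defs
begin

text \<open>
  Write \<open>\<phi>\<^sub>i\<close> for the \<open>i\<close>-th iterated Lie derivative of \<open>y\<^sub>1\<close> along \<open>h\<^sub>1\<close> and \<open>X\<^sub>j\<close> for the \<open>j\<close>-th
  iterated bracket of \<open>h\<^sub>1\<close> with \<open>h\<^sub>2\<close>. The relation \<open>L\<^bsub>[h,X]\<^esub> = L\<^sub>h L\<^sub>X - L\<^sub>X L\<^sub>h\<close> shows that the pairing of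
  \<open>d\<phi>\<^sub>i\<close> with \<open>X\<^sub>j\<close> vanishes for \<open>i + j < n - 1\<close> and not for \<open>i + j = n - 1\<close>, so the \<open>d\<phi>\<^sub>i\<close> are independent
  and \<open>S\<close> has nonsingular Jacobian. Along a curve, \<open>\<phi>\<^sub>i\<close> has velocity \<open>u\<^sub>1 \<phi>\<^sub>i\<^sub>+\<^sub>1 + u\<^sub>2 L\<^bsub>h2\<^esub> \<phi>\<^sub>i\<close>, which is
  the chained system; conversely the velocity of \<open>S(y)\<close> determines that of \<open>y\<close> since \<open>dS\<close> is
  injective. For maneuverability the speed and the steering angle are read off a logarithm of the
  velocity, further states are arc length derivatives of the angle, and \<open>S\<close> is inverted, the
  inverse being continuous by invariance of domain.
\<close>

section \<open>Functions of class \<open>C\<^sup>k\<close>\<close>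

text \<open>Derivatives at a point of an open set depend only on the values in that set, so
  agreement on \<open>U\<close> passes to all directional derivatives. Agreement is symmetric, hence
  one implication, for arbitrary \<open>f\<close> and \<open>g\<close>, suffices.\<close>

lemma Ck_on_cong:
  assumes "open U" "\<And>x. x \<in> U \<Longrightarrow> f x = g x"
  shows "Ck_on k f U \<longleftrightarrow> Ck_on k g U"
proof -
  have "Ck_on k f U" if "Ck_on k g U" "\<And>x. x \<in> U \<Longrightarrow> f x = g x" for f g
    using that
  proof (induction k arbitrary: f g)
    case 0
    then show ?case by (simp cong: continuous_on_cong)
  next
    case (Suc k)
    have D: "f differentiable (at x)" "frechet_derivative g (at x) = frechet_derivative f (at x)"
      if "x \<in> U" for x
    proof -
      have "(g has_derivative frechet_derivative g (at x)) (at x)"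
        using Suc.prems that by (simp add: frechet_derivative_works)
      then have "(f has_derivative frechet_derivative g (at x)) (at x)"
        by (rule has_derivative_transform_within_open[OF _ assms(1) that]) (simp add: Suc.prems(2))
      then show "f differentiable (at x)" "frechet_derivative g (at x) = frechet_derivative f (at x)"
        by (auto simp: differentiable_def intro: frechet_derivative_at)
    qed
    have "Ck_on k (\<lambda>x. frechet_derivative f (at x) v) U" for v
      by (rule Suc.IH[where g = "\<lambda>x. frechet_derivative g (at x) v"]) (use Suc.prems D in simp_all)
    with D(1) show ?case by simp
  qed
  from this[of g f] this[of f g] assms(2) show ?thesis by auto
qed

lemma Ck_on_subset: "Ck_on k f U \<Longrightarrow> V \<subseteq> U \<Longrightarrow> Ck_on k f V"
  by (induction k arbitrary: f) (auto intro: continuous_on_subset)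

lemma Ck_on_Suc_imp: "Ck_on (Suc k) f U \<Longrightarrow> Ck_on k f U"
proof (induction k arbitrary: f)
  case 0
  then show ?case
    by (auto intro!: continuous_at_imp_continuous_on differentiable_imp_continuous_within)
next
  case (Suc k)
  from Suc.prems have "Ck_on (Suc k) (\<lambda>x. frechet_derivative f (at x) v) U" for v
    by simp
  then have "Ck_on k (\<lambda>x. frechet_derivative f (at x) v) U" for v
    by (rule Suc.IH)
  moreover have "f differentiable (at x)" if "x \<in> U" for x
    using Suc.prems that by simp
  ultimately show ?case by simp
qed

lemma Ck_on_mono:
  assumes "Ck_on k f U" "j \<le> k"
  shows "Ck_on j f U"
  using assms(2,1) by (induction rule: inc_induct) (use Ck_on_Suc_imp in blast)+

lemma Ck_on_imp_continuous_on: "Ck_on k f U \<Longrightarrow> continuous_on U f"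
  using Ck_on_mono[of k f U 0] by simp

text \<open>Continuity and differentiability are checked at single points. This glues regularity
  that is known only near each point, as for a coordinate that comes from varying product
  charts.\<close>

lemma Ck_on_locally:
  assumes "\<And>x. x \<in> U \<Longrightarrow> \<exists>V. open V \<and> x \<in> V \<and> Ck_on k f V"
  shows "Ck_on k f U"
  using assms
proof (induction k arbitrary: f)
  case 0
  then show ?case
    by (simp add: continuous_at_imp_continuous_on) (metis continuous_at_imp_continuous_on continuous_on_eq_continuous_at)
next
  case (Suc k)
  have "Ck_on k (\<lambda>x. frechet_derivative f (at x) v) U" for v
  proof (rule Suc.IH)
    fix x assume "x \<in> U"
    from Suc.prems[OF this] show "\<exists>V. open V \<and> x \<in> V \<and> Ck_on k (\<lambda>x. frechet_derivative f (at x) v) V"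
      by auto
  qed
  moreover have "f differentiable (at x)" if "x \<in> U" for x
    using Suc.prems[OF that] by auto
  ultimately show ?case by simp
qed

lemma Ck_on_const: "Ck_on k (\<lambda>x. c) U"
  by (induction k arbitrary: c) auto

text \<open>Allows any formula for the derivative in place of \<open>frechet_derivative\<close>, so
  that the closure properties below follow by induction from the usual rules of
  differentiation.\<close>

lemma Ck_on_SucI:
  assumes U: "open U" and f: "\<And>x. x \<in> U \<Longrightarrow> (f has_derivative f' x) (at x)"
    and f': "\<And>v. Ck_on k (\<lambda>x. f' x v) U"
  shows "Ck_on (Suc k) f U"
proof -
  have "frechet_derivative f (at x) = f' x" if "x \<in> U" for x
    using f[OF that] frechet_derivative_at by metis
  then have "Ck_on k (\<lambda>x. frechet_derivative f (at x) v) U" for v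
    using Ck_on_cong[OF U, of "\<lambda>x. frechet_derivative f (at x) v" "\<lambda>x. f' x v" k] f' by simp
  moreover have "f differentiable (at x)" if "x \<in> U" for x
    using f[OF that] by (rule differentiableI)
  ultimately show ?thesis by simp
qed

lemma Ck_on_has_derivative:
  "Ck_on (Suc k) f U \<Longrightarrow> x \<in> U \<Longrightarrow> (f has_derivative frechet_derivative f (at x)) (at x)"
  by (simp add: frechet_derivative_works)

section \<open>Closure properties of \<open>Ck_on\<close>\<close>

lemma Ck_on_add:
  assumes "open U" "Ck_on k f U" "Ck_on k g U"
  shows "Ck_on k (\<lambda>x. f x + g x) U"
  using assms(2,3)
proof (induction k arbitrary: f g)
  case 0
  then show ?case by (simp add: continuous_on_add)
next
  case (Suc k)
  show ?case
  proof (rule Ck_on_SucI[OF assms(1)])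
    fix x assume "x \<in> U"
    then show "((\<lambda>x. f x + g x) has_derivative
        (\<lambda>v. frechet_derivative f (at x) v + frechet_derivative g (at x) v)) (at x)"
      by (intro has_derivative_add) (use Suc.prems Ck_on_has_derivative in blast)+
  next
    fix v show "Ck_on k (\<lambda>x. frechet_derivative f (at x) v + frechet_derivative g (at x) v) U"
      by (rule Suc.IH) (use Suc.prems in auto)
  qed
qed

lemma Ck_on_sum:
  assumes "open U" "\<And>i. i \<in> I \<Longrightarrow> Ck_on k (f i) U"
  shows "Ck_on k (\<lambda>x. \<Sum>i\<in>I. f i x) U"
  using assms(2)
  by (induction I rule: infinite_finite_induct) (auto simp: Ck_on_const Ck_on_add[OF assms(1)])

lemma Ck_on_bounded_linear:
  assumes "open U" "bounded_linear L" "Ck_on k f U"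
  shows "Ck_on k (\<lambda>x. L (f x)) U"
  using assms(3)
proof (induction k arbitrary: f)
  case 0
  then show ?case using assms(2) by (simp add: bounded_linear.continuous_on)
next
  case (Suc k)
  show ?case
  proof (rule Ck_on_SucI[OF assms(1)])
    fix x assume "x \<in> U"
    then show "((\<lambda>x. L (f x)) has_derivative (\<lambda>v. L (frechet_derivative f (at x) v))) (at x)"
      by (intro bounded_linear.has_derivative[OF assms(2)] Ck_on_has_derivative[OF Suc.prems])
  next
    fix v show "Ck_on k (\<lambda>x. L (frechet_derivative f (at x) v)) U"
      by (rule Suc.IH) (use Suc.prems in auto)
  qed
qed

lemma Ck_on_diff:
  assumes "open U" "Ck_on k f U" "Ck_on k g U"
  shows "Ck_on k (\<lambda>x. f x - g x) U"
  using Ck_on_add[OF assms(1,2) Ck_on_bounded_linear[OF assms(1) _ assms(3), of uminus]]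
    bounded_linear_minus[OF bounded_linear_ident] by simp

lemma Ck_on_scaleR:
  assumes "open U" "Ck_on k f U" "Ck_on k g U"
  shows "Ck_on k (\<lambda>x. f x *\<^sub>R g x) U"
  using assms(2,3)
proof (induction k arbitrary: f g)
  case 0
  then show ?case by (simp add: continuous_on_scaleR)
next
  case (Suc k)
  \<comment> \<open>In the product rule one factor stays undifferentiated; it must be lowered to
    class \<open>k\<close> before the induction hypothesis applies.\<close>
  note d = Ck_on_Suc_imp[OF Suc.prems(1)] Ck_on_Suc_imp[OF Suc.prems(2)]
  show ?case
  proof (rule Ck_on_SucI[OF assms(1)])
    fix x assume "x \<in> U"
    then show "((\<lambda>x. f x *\<^sub>R g x) has_derivative
        (\<lambda>v. f x *\<^sub>R frechet_derivative g (at x) v + frechet_derivative f (at x) v *\<^sub>R g x)) (at x)"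
      by (intro has_derivative_scaleR) (use Suc.prems Ck_on_has_derivative in blast)+
  next
    fix v show "Ck_on k (\<lambda>x. f x *\<^sub>R frechet_derivative g (at x) v +
        frechet_derivative f (at x) v *\<^sub>R g x) U"
      by (intro Ck_on_add[OF assms(1)] Suc.IH) (use Suc.prems d in auto)
  qed
qed

lemma frechet_derivative_expand:
  assumes "f differentiable (at x)"
  shows "frechet_derivative f (at x) w = (\<Sum>b\<in>Basis. (w \<bullet> b) *\<^sub>R frechet_derivative f (at x) b)"
  using linear_frechet_derivative[OF assms]
  by (subst euclidean_representation[of w, symmetric]) (simp add: linear_sum linear_cmul)

text \<open>\<open>Ck_on\<close> controls derivatives in fixed directions only. Expanding the
  varying direction \<open>h x\<close> in the basis turns the derivative into a sum of products of
  functions of class \<open>k\<close>.\<close>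

lemma Ck_on_directional_derivative:
  assumes U: "open U" and f: "Ck_on (Suc k) f U" and h: "Ck_on k h U"
  shows "Ck_on k (\<lambda>x. frechet_derivative f (at x) (h x)) U"
  using f frechet_derivative_expand[of f _ "h _"]
  by (subst Ck_on_cong[OF U])
    (auto intro!: Ck_on_sum Ck_on_scaleR Ck_on_bounded_linear[OF U _ h] bounded_linear_inner_left U)

lemma Ck_on_vec:
  fixes f :: "'a::euclidean_space \<Rightarrow> real ^ 'n::finite"
  assumes "open U" "\<And>j. Ck_on k (\<lambda>x. f x $ j) U"
  shows "Ck_on k f U"
proof -
  have *: "f = (\<lambda>x. \<Sum>j\<in>UNIV. (f x $ j) *\<^sub>R axis j 1)"
    by (rule ext) (simp add: vec_eq_iff axis_def if_distrib cong: if_cong)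
  then show ?thesis
    by (subst *) (intro Ck_on_sum Ck_on_scaleR Ck_on_const assms)
qed

section \<open>Symmetry of second derivatives\<close>

text \<open>Both iterated derivatives are limits of the second difference quotient, by two applications
  of the mean value theorem in either order.\<close>

lemma second_difference:
  fixes f :: "'a::euclidean_space \<Rightarrow> real"
  assumes f: "Ck_on 2 f (ball x r)" and "0 < t" "t * norm v + t * norm w < r"
  obtains \<sigma> \<tau> where "0 < \<sigma>" "\<sigma> < t" "0 < \<tau>" "\<tau> < t"
    "f (x + t *\<^sub>R v + t *\<^sub>R w) - f (x + t *\<^sub>R v) - (f (x + t *\<^sub>R w) - f x) =
      t * t * frechet_derivative (\<lambda>z. frechet_derivative f (at z) v) (at (x + \<sigma> *\<^sub>R v + \<tau> *\<^sub>R w)) w"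
proof -
  have f1: "f differentiable (at z)" "(\<lambda>z. frechet_derivative f (at z) v) differentiable (at z)"
    if "z \<in> ball x r" for z
    using f that by (auto simp: numeral_2_eq_2)
  have inb: "x + \<sigma> *\<^sub>R v + \<tau> *\<^sub>R w \<in> ball x r"
    if "0 \<le> \<sigma>" "\<sigma> \<le> t" "0 \<le> \<tau>" "\<tau> \<le> t" for \<sigma> \<tau>
  proof -
    have "norm (\<sigma> *\<^sub>R v + \<tau> *\<^sub>R w) \<le> \<sigma> * norm v + \<tau> * norm w"
      using norm_triangle_ineq[of "\<sigma> *\<^sub>R v" "\<tau> *\<^sub>R w"] that by simp
    also have "\<dots> \<le> t * norm v + t * norm w"
      using that by (intro add_mono mult_right_mono) auto
    finally show ?thesis
      using assms(3) norm_minus_cancel[of "\<sigma> *\<^sub>R v + \<tau> *\<^sub>R w"]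
      by (simp add: dist_norm add.assoc del: norm_minus_cancel)
  qed
  have inb0: "x + s *\<^sub>R v \<in> ball x r" if "0 \<le> s" "s \<le> t" for s
    using inb[of s 0] that \<open>0 < t\<close> by simp
  \<comment> \<open>The second difference equals \<open>G t - G 0\<close>. The mean value theorem
    for \<open>G\<close> produces a derivative along \<open>v\<close>, and the one for
    \<open>H\<close> then differentiates along \<open>w\<close>.\<close>
  define G where "G s = f (x + s *\<^sub>R v + t *\<^sub>R w) - f (x + s *\<^sub>R v)" for s
  define D where "D s = frechet_derivative f (at (x + s *\<^sub>R v + t *\<^sub>R w)) v -
      frechet_derivative f (at (x + s *\<^sub>R v)) v" for s
  have der: "((\<lambda>s. F (p s)) has_real_derivative frechet_derivative F (at (p s)) u) (at s)"
    if "F differentiable (at (p s))" "(p has_vector_derivative u) (at s)"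
    for F :: "'a \<Rightarrow> real" and p u s
  proof -
    have F: "(F has_derivative frechet_derivative F (at (p s))) (at (p s))"
      using that by (simp add: frechet_derivative_works)
    have "((\<lambda>s. F (p s)) has_derivative (\<lambda>h. frechet_derivative F (at (p s)) (h *\<^sub>R u))) (at s)"
      using has_derivative_compose[OF that(2)[unfolded has_vector_derivative_def] F] .
    moreover have "(\<lambda>h. frechet_derivative F (at (p s)) (h *\<^sub>R u)) =
        (*) (frechet_derivative F (at (p s)) u)"
      using linear_cmul[OF linear_frechet_derivative[OF that(1)]] by (auto simp: mult.commute)
    ultimately show ?thesis by (simp add: has_field_derivative_def)
  qed
  have "(G has_real_derivative D s) (at s)" if "0 \<le> s" "s \<le> t" for s
    unfolding G_def D_def
    by (intro DERIV_diff der f1 inb0 inb)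
       (use that \<open>0 < t\<close> in \<open>auto intro!: derivative_eq_intros\<close>)
  from MVT2[OF \<open>0 < t\<close>, of G D] this obtain \<sigma> where \<sigma>: "0 < \<sigma>" "\<sigma> < t" "G t - G 0 = t * D \<sigma>"
    by auto
  define H where "H s = frechet_derivative f (at (x + \<sigma> *\<^sub>R v + s *\<^sub>R w)) v" for s
  have "(H has_real_derivative
      frechet_derivative (\<lambda>z. frechet_derivative f (at z) v) (at (x + \<sigma> *\<^sub>R v + s *\<^sub>R w)) w) (at s)"
    if "0 \<le> s" "s \<le> t" for s
    unfolding H_def
    by (intro der f1 inb) (use that \<sigma> in \<open>auto intro!: derivative_eq_intros\<close>)
  from MVT2[OF \<open>0 < t\<close>, of H, OF this] obtain \<tau> where \<tau>: "0 < \<tau>" "\<tau> < t"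
    "H t - H 0 = t * frechet_derivative (\<lambda>z. frechet_derivative f (at z) v)
        (at (x + \<sigma> *\<^sub>R v + \<tau> *\<^sub>R w)) w"
    by auto
  show ?thesis
    by (rule that[OF \<sigma>(1,2) \<tau>(1,2)]) (use \<sigma>(3) \<tau>(3) in \<open>simp add: G_def H_def D_def\<close>)
qed

lemma second_derivative_symmetric:
  fixes f :: "'a::euclidean_space \<Rightarrow> real"
  assumes "open U" "x \<in> U" "Ck_on 2 f U"
  shows "frechet_derivative (\<lambda>z. frechet_derivative f (at z) v) (at x) w =
    frechet_derivative (\<lambda>z. frechet_derivative f (at z) w) (at x) v"
proof -
  obtain r where r: "r > 0" "ball x r \<subseteq> U"
    using assms(1,2) openE by blast
  have f: "Ck_on 2 f (ball x r)"
    using Ck_on_subset[OF assms(3) r(2)] .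
  define B where "B v w z = frechet_derivative (\<lambda>z. frechet_derivative f (at z) v) (at z) w" for v w z
  \<comment> \<open>Stated for all \<open>v\<close> and \<open>w\<close> because it is used in both
    orders; \<open>p t\<close> is the intermediate point of the second difference with step
    \<open>t\<close>.\<close>
  have lim: "\<exists>p. (p \<longlongrightarrow> x) (at_right 0) \<and> (\<forall>\<^sub>F t in at_right 0.
      f (x + t *\<^sub>R v + t *\<^sub>R w) - f (x + t *\<^sub>R v) - (f (x + t *\<^sub>R w) - f x) = t * t * B v w (p t))" for v w
  proof -
    define N where "N = norm v + norm w + 1"
    have N: "N > 0" by (simp add: N_def add_nonneg_pos)
    have "\<exists>\<sigma> \<tau>. 0 < \<sigma> \<and> \<sigma> < t \<and> 0 < \<tau> \<and> \<tau> < t \<and>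
        f (x + t *\<^sub>R v + t *\<^sub>R w) - f (x + t *\<^sub>R v) - (f (x + t *\<^sub>R w) - f x) =
        t * t * B v w (x + \<sigma> *\<^sub>R v + \<tau> *\<^sub>R w)" if "0 < t" "t < r / N" for t
    proof -
      have "t * norm v + t * norm w < t * N" using that by (simp add: N_def algebra_simps)
      also have "\<dots> < r" using that N by (simp add: field_simps)
      finally show ?thesis
        unfolding B_def using second_difference[OF f that(1)] by metis
    qed
    then obtain \<sigma> \<tau> where st: "0 < \<sigma> t \<and> \<sigma> t < t \<and> 0 < \<tau> t \<and> \<tau> t < t \<and>
        f (x + t *\<^sub>R v + t *\<^sub>R w) - f (x + t *\<^sub>R v) - (f (x + t *\<^sub>R w) - f x) =
        t * t * B v w (x + \<sigma> t *\<^sub>R v + \<tau> t *\<^sub>R w)" if "0 < t" "t < r / N" for t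
      by metis
    have ev: "\<forall>\<^sub>F t in at_right 0. 0 < t \<and> t < r / N"
      using N r(1) by (auto simp: eventually_at_right_field intro!: exI[of _ "r / N"])
    have "(\<sigma> \<longlongrightarrow> 0) (at_right 0)" "(\<tau> \<longlongrightarrow> 0) (at_right 0)"
      by (rule tendsto_sandwich[of "\<lambda>_. 0" _ _ "\<lambda>t. t"];
          use eventually_mono[OF ev, of "\<lambda>t. 0 \<le> \<sigma> t"] eventually_mono[OF ev, of "\<lambda>t. \<sigma> t \<le> t"]
            eventually_mono[OF ev, of "\<lambda>t. 0 \<le> \<tau> t"] eventually_mono[OF ev, of "\<lambda>t. \<tau> t \<le> t"] st
          in \<open>force intro: less_imp_le tendsto_intros\<close>)+
    then have "((\<lambda>t. x + \<sigma> t *\<^sub>R v + \<tau> t *\<^sub>R w) \<longlongrightarrow> x + 0 *\<^sub>R v + 0 *\<^sub>R w) (at_right 0)"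
      by (intro tendsto_intros)
    then show ?thesis
      using st by (intro exI[of _ "\<lambda>t. x + \<sigma> t *\<^sub>R v + \<tau> t *\<^sub>R w"] conjI eventually_mono[OF ev]) auto
  qed
  have cont: "isCont (B v w) x" for v w
  proof -
    have "Ck_on 0 (B v w) U"
      using assms(3) unfolding B_def by (simp add: numeral_2_eq_2)
    then show ?thesis using assms(1,2) by (simp add: continuous_on_eq_continuous_at)
  qed
  from lim[of v w] obtain p where p: "(p \<longlongrightarrow> x) (at_right 0)" "\<forall>\<^sub>F t in at_right 0.
      f (x + t *\<^sub>R v + t *\<^sub>R w) - f (x + t *\<^sub>R v) - (f (x + t *\<^sub>R w) - f x) = t * t * B v w (p t)"
    by blast
  from lim[of w v] obtain q where q: "(q \<longlongrightarrow> x) (at_right 0)" "\<forall>\<^sub>F t in at_right 0.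
      f (x + t *\<^sub>R w + t *\<^sub>R v) - f (x + t *\<^sub>R w) - (f (x + t *\<^sub>R v) - f x) = t * t * B w v (q t)"
    by blast
  \<comment> \<open>The second difference is symmetric in \<open>v\<close> and \<open>w\<close>.
    Dividing by \<open>t * t\<close> equates the two iterated derivatives at two points that both
    tend to \<open>x\<close>.\<close>
  have "\<forall>\<^sub>F t in at_right (0::real). B v w (p t) = B w v (q t)"
    using p(2) q(2) eventually_at_right_less[of 0]
  proof eventually_elim
    case (elim t)
    have *: "x + t *\<^sub>R v + t *\<^sub>R w = x + t *\<^sub>R w + t *\<^sub>R v" by (simp add: algebra_simps)
    have "t * t * B v w (p t) = t * t * B w v (q t)"
      using elim(1)[unfolded *] elim(2) by linarith
    with elim show ?case by simp
  qed
  moreover have "((\<lambda>t. B v w (p t)) \<longlongrightarrow> B v w x) (at_right 0)" "((\<lambda>t. B w v (q t)) \<longlongrightarrow> B w v x) (at_right 0)"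
    using isCont_tendsto_compose[OF cont p(1)] isCont_tendsto_compose[OF cont q(1)] by auto
  ultimately have "B v w x = B w v x"
    using tendsto_cong[of "\<lambda>t. B v w (p t)" "\<lambda>t. B w v (q t)" "at_right 0"]
      tendsto_unique[OF trivial_limit_at_right_real] by blast
  then show ?thesis by (simp add: B_def)
qed

section \<open>Independence of iterated Lie derivatives\<close>

text \<open>The product rule for the basis expansion of the direction \<open>X z\<close>: one term
  keeps the direction frozen at \<open>X x\<close>, the other differentiates the field. It isolates
  the second derivative of \<open>f\<close>, which cancels in a Lie bracket.\<close>

lemma frechet_derivative_directional_derivative:
  fixes f :: "'a::euclidean_space \<Rightarrow> real"
  assumes U: "open U" "x \<in> U" and f: "Ck_on 2 f U" and X: "Ck_on 1 X U"
  shows "frechet_derivative (\<lambda>z. frechet_derivative f (at z) (X z)) (at x) w =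
    frechet_derivative (\<lambda>z. frechet_derivative f (at z) (X x)) (at x) w +
    frechet_derivative f (at x) (frechet_derivative X (at x) w)"
proof -
  have d: "f differentiable (at z)" if "z \<in> U" for z
    using f that by (simp add: numeral_2_eq_2)
  define B where "B b = frechet_derivative (\<lambda>z. frechet_derivative f (at z) b) (at x)" for b
  have B: "((\<lambda>z. frechet_derivative f (at z) b) has_derivative B b) (at x)" for b
    unfolding B_def using f U by (simp add: numeral_2_eq_2 frechet_derivative_works)
  have X': "(X has_derivative frechet_derivative X (at x)) (at x)"
    using X U by (simp add: frechet_derivative_works)
  have "((\<lambda>z. \<Sum>b\<in>Basis. (X z \<bullet> b) * frechet_derivative f (at z) b) has_derivative
      (\<lambda>w. \<Sum>b\<in>Basis. (X x \<bullet> b) * B b w +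
        (frechet_derivative X (at x) w \<bullet> b) * frechet_derivative f (at x) b)) (at x)"
    by (intro has_derivative_sum has_derivative_mult has_derivative_inner_left X' B)
  then have "((\<lambda>z. frechet_derivative f (at z) (X z)) has_derivative
      (\<lambda>w. \<Sum>b\<in>Basis. (X x \<bullet> b) * B b w +
        (frechet_derivative X (at x) w \<bullet> b) * frechet_derivative f (at x) b)) (at x)"
    by (rule has_derivative_transform_within_open[OF _ U])
      (simp add: frechet_derivative_expand[OF d, of _ "X _"])
  note 1 = frechet_derivative_at[OF this, symmetric]
  have "((\<lambda>z. \<Sum>b\<in>Basis. (X x \<bullet> b) * frechet_derivative f (at z) b) has_derivative
      (\<lambda>w. \<Sum>b\<in>Basis. (X x \<bullet> b) * B b w)) (at x)"
    by (intro has_derivative_sum has_derivative_mult_right B)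
  then have "((\<lambda>z. frechet_derivative f (at z) (X x)) has_derivative
      (\<lambda>w. \<Sum>b\<in>Basis. (X x \<bullet> b) * B b w)) (at x)"
    by (rule has_derivative_transform_within_open[OF _ U])
      (simp add: frechet_derivative_expand[OF d, of _ "X _"])
  note 2 = frechet_derivative_at[OF this, symmetric]
  show ?thesis
    unfolding 1 2 by (simp add: sum.distrib
        frechet_derivative_expand[OF d[OF U(2)], of "frechet_derivative X (at x) w"])
qed

text \<open>The field \<open>X\<close> is the iterated Lie bracket of \<open>h1\<close> (\<open>j\<close> times) with \<open>h2\<close>.\<close>

lemma iterated_bracket_pairing:
  fixes \<phi> :: "nat \<Rightarrow> 'a::euclidean_space \<Rightarrow> real"
  assumes U: "open U"
    and \<phi>: "\<And>i. i \<le> m \<Longrightarrow> Ck_on (Suc m - i) (\<phi> i) U"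
    and \<phi>_Suc: "\<And>i z. i < m \<Longrightarrow> z \<in> U \<Longrightarrow> \<phi> (Suc i) z = frechet_derivative (\<phi> i) (at z) (h1 z)"
    and h1: "Ck_on m h1 U" and h2: "Ck_on m h2 U"
    and zero: "\<And>i z. i < m \<Longrightarrow> z \<in> U \<Longrightarrow> frechet_derivative (\<phi> i) (at z) (h2 z) = 0"
    and nonzero: "\<And>z. z \<in> U \<Longrightarrow> frechet_derivative (\<phi> m) (at z) (h2 z) \<noteq> 0"
    and "j \<le> m"
  shows "\<exists>X. Ck_on (m - j) X U \<and>
    (\<forall>i z. i + j < m \<longrightarrow> z \<in> U \<longrightarrow> frechet_derivative (\<phi> i) (at z) (X z) = 0) \<and>
    (\<forall>i z. i + j = m \<longrightarrow> z \<in> U \<longrightarrow> frechet_derivative (\<phi> i) (at z) (X z) \<noteq> 0)"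
  using \<open>j \<le> m\<close>
proof (induction j)
  case 0
  show ?case
    by (rule exI[of _ h2]) (use zero nonzero h2 in simp)
next
  case (Suc j)
  then obtain X where X: "Ck_on (m - j) X U"
    and X0: "\<And>i z. i + j < m \<Longrightarrow> z \<in> U \<Longrightarrow> frechet_derivative (\<phi> i) (at z) (X z) = 0"
    and X1: "\<And>i z. i + j = m \<Longrightarrow> z \<in> U \<Longrightarrow> frechet_derivative (\<phi> i) (at z) (X z) \<noteq> 0"
    by auto
  have X_Suc: "Ck_on (Suc (m - Suc j)) X U"
    using X Suc.prems by (simp add: Suc_diff_Suc)
  have h1_Suc: "Ck_on (Suc (m - Suc j)) h1 U"
    by (rule Ck_on_mono[OF h1]) (use Suc.prems in simp)
  \<comment> \<open>The coordinate expression of the Lie bracket of \<open>h1\<close> and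
    \<open>X\<close>; it costs one order of differentiability.\<close>
  define X' where "X' z = frechet_derivative X (at z) (h1 z) - frechet_derivative h1 (at z) (X z)" for z
  have "Ck_on (m - Suc j) X' U"
    unfolding X'_def
    by (intro Ck_on_diff Ck_on_directional_derivative U X_Suc h1_Suc
        Ck_on_Suc_imp[OF X_Suc] Ck_on_Suc_imp[OF h1_Suc])
  \<comment> \<open>Here \<open>i + j < m\<close>, so the pairing of \<open>\<phi> i\<close> with
    \<open>X\<close> vanishes on all of \<open>U\<close>, and so does its derivative along
    \<open>h1\<close>. Of the two terms of the bracket relation only the one with
    \<open>\<phi> (Suc i)\<close> survives.\<close>
  moreover have pairing: "frechet_derivative (\<phi> i) (at z) (X' z) = - frechet_derivative (\<phi> (Suc i)) (at z) (X z)"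
    if "i + Suc j \<le> m" "z \<in> U" for i z
  proof -
    have f: "Ck_on 2 (\<phi> i) U"
      by (rule Ck_on_mono[OF \<phi>]) (use that in simp_all)
    have X1: "Ck_on 1 X U" and h11: "Ck_on 1 h1 U"
      by (rule Ck_on_mono[OF X_Suc] Ck_on_mono[OF h1_Suc], simp)+
    have lin: "linear (frechet_derivative (\<phi> i) (at z))"
      using f that by (intro linear_frechet_derivative) (simp add: numeral_2_eq_2)
    have "((\<lambda>z. frechet_derivative (\<phi> i) (at z) (X z)) has_derivative (\<lambda>w. 0)) (at z)"
      by (rule has_derivative_transform_within_open[OF has_derivative_const[of 0] U that(2)])
        (use X0 that(1) in simp)
    from frechet_derivative_at[OF this]
    have 1: "0 = frechet_derivative (\<lambda>y. frechet_derivative (\<phi> i) (at y) (X z)) (at z) (h1 z) +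
        frechet_derivative (\<phi> i) (at z) (frechet_derivative X (at z) (h1 z))"
      using frechet_derivative_directional_derivative[OF U that(2) f X1, of "h1 z"] by metis
    have "((\<phi> (Suc i)) has_derivative frechet_derivative (\<phi> (Suc i)) (at z)) (at z)"
    proof (rule Ck_on_has_derivative[OF _ that(2)])
      show "Ck_on (Suc 0) (\<phi> (Suc i)) U"
        by (rule Ck_on_mono[OF \<phi>]) (use that in simp_all)
    qed
    then have "((\<lambda>z. frechet_derivative (\<phi> i) (at z) (h1 z)) has_derivative
        frechet_derivative (\<phi> (Suc i)) (at z)) (at z)"
      by (rule has_derivative_transform_within_open[OF _ U that(2)]) (use \<phi>_Suc that(1) in simp)
    from frechet_derivative_at[OF this]
    have 2: "frechet_derivative (\<phi> (Suc i)) (at z) (X z) =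
        frechet_derivative (\<lambda>y. frechet_derivative (\<phi> i) (at y) (h1 z)) (at z) (X z) +
        frechet_derivative (\<phi> i) (at z) (frechet_derivative h1 (at z) (X z))"
      using frechet_derivative_directional_derivative[OF U that(2) f h11, of "X z"] by metis
    \<comment> \<open>The facts \<open>1\<close> and \<open>2\<close> contain the second derivative
      of \<open>\<phi> i\<close> in the directions \<open>X z\<close> and \<open>h1 z\<close>, in
      opposite orders; by symmetry it drops out.\<close>
    show ?thesis
      using 1 2 second_derivative_symmetric[OF U that(2) f, of "X z" "h1 z"]
      by (simp add: X'_def linear_diff[OF lin])
  qed
  \<comment> \<open>The relation trades one bracket for one more Lie derivative, so the sum of the
    two indices, and with it both claims, carries over from \<open>j\<close>.\<close>
  ultimately show ?case
    by (intro exI[of _ X'] conjI) (auto simp: X0 X1)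
qed

text \<open>Let \<open>l\<close> be the largest index with a nonzero coefficient and evaluate the
  combination on the bracket field with \<open>j = m - l\<close>. Terms above \<open>l\<close> have
  zero coefficient, terms below \<open>l\<close> have zero pairing, and the term at \<open>l\<close>
  is nonzero.\<close>

lemma iterated_derivatives_independent:
  fixes \<phi> :: "nat \<Rightarrow> 'a::euclidean_space \<Rightarrow> real"
  assumes U: "open U" "x \<in> U"
    and \<phi>: "\<And>i. i \<le> m \<Longrightarrow> Ck_on (Suc m - i) (\<phi> i) U"
    and \<phi>_Suc: "\<And>i z. i < m \<Longrightarrow> z \<in> U \<Longrightarrow> \<phi> (Suc i) z = frechet_derivative (\<phi> i) (at z) (h1 z)"
    and h1: "Ck_on m h1 U" and h2: "Ck_on m h2 U"
    and zero: "\<And>i z. i < m \<Longrightarrow> z \<in> U \<Longrightarrow> frechet_derivative (\<phi> i) (at z) (h2 z) = 0"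
    and nonzero: "\<And>z. z \<in> U \<Longrightarrow> frechet_derivative (\<phi> m) (at z) (h2 z) \<noteq> 0"
    and comb: "\<And>w. (\<Sum>i\<le>m. c i * frechet_derivative (\<phi> i) (at x) w) = 0"
    and "i \<le> m"
  shows "c i = 0"
proof (rule ccontr)
  assume "c i \<noteq> 0"
  define l where "l = Max {i. i \<le> m \<and> c i \<noteq> 0}"
  have fin: "finite {i. i \<le> m \<and> c i \<noteq> 0}" by simp
  have l: "l \<le> m" "c l \<noteq> 0"
    using Max_in[OF fin] \<open>c i \<noteq> 0\<close> \<open>i \<le> m\<close> unfolding l_def[symmetric] by auto
  have gt: "c k = 0" if "l < k" "k \<le> m" for k
    using Max_ge[OF fin, of k] that unfolding l_def[symmetric] by auto
  have "m - l \<le> m" by simp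
  from iterated_bracket_pairing[OF U(1) \<phi> \<phi>_Suc h1 h2 zero nonzero this]
  obtain X where
    X0: "\<forall>i z. i + (m - l) < m \<longrightarrow> z \<in> U \<longrightarrow> frechet_derivative (\<phi> i) (at z) (X z) = 0"
    and X1: "\<forall>i z. i + (m - l) = m \<longrightarrow> z \<in> U \<longrightarrow> frechet_derivative (\<phi> i) (at z) (X z) \<noteq> 0"
    by blast
  have "(\<Sum>i\<le>m. c i * frechet_derivative (\<phi> i) (at x) (X x)) =
      (\<Sum>i\<in>{l}. c i * frechet_derivative (\<phi> i) (at x) (X x))"
  proof (rule sum.mono_neutral_right)
    show "\<forall>i\<in>{..m} - {l}. c i * frechet_derivative (\<phi> i) (at x) (X x) = 0"
    proof
      fix i assume "i \<in> {..m} - {l}"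
      then consider "l < i" "i \<le> m" | "i < l" by force
      then show "c i * frechet_derivative (\<phi> i) (at x) (X x) = 0"
        by cases (use gt X0 U(2) l(1) in auto)
    qed
  qed (use l in auto)
  with comb X1 U l show False by simp
qed

section \<open>From independent differentials to a nonsingular Jacobian\<close>

lemma jacobian_component:
  fixes \<sigma> :: "real ^ 'n::finite \<Rightarrow> real ^ 'm::finite"
  assumes "\<sigma> differentiable (at x)"
  shows "(jacobian \<sigma> (at x) *v w) $ j = frechet_derivative (\<lambda>z. \<sigma> z $ j) (at x) w"
proof -
  have "(\<sigma> has_derivative (\<lambda>w. jacobian \<sigma> (at x) *v w)) (at x)"
    using assms jacobian_works by blast
  from bounded_linear.has_derivative[OF bounded_linear_vec_nth this, of j]
  show ?thesis by (simp add: frechet_derivative_at[symmetric])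
qed

text \<open>The rows of the Jacobian are the differentials of the \<open>\<phi> i\<close>. If the
  determinant vanished, a nonzero kernel vector \<open>c\<close> of the transpose would be a linear
  relation between these rows.\<close>

lemma det_jacobian_iterated_derivatives:
  fixes \<sigma> :: "real ^ 'n::finite \<Rightarrow> real ^ 'n" and \<phi> :: "nat \<Rightarrow> real ^ 'n \<Rightarrow> real"
  assumes U: "open U" "x \<in> U"
    and e: "bij_betw e {..m} UNIV"
    and \<sigma>: "\<And>i. i \<le> m \<Longrightarrow> (\<lambda>z. \<sigma> z $ e i) = \<phi> i" and \<sigma>_diff: "\<sigma> differentiable (at x)"
    and \<phi>: "\<And>i. i \<le> m \<Longrightarrow> Ck_on (Suc m - i) (\<phi> i) U"
    and \<phi>_Suc: "\<And>i z. i < m \<Longrightarrow> z \<in> U \<Longrightarrow> \<phi> (Suc i) z = frechet_derivative (\<phi> i) (at z) (h1 z)"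
    and h1: "Ck_on m h1 U" and h2: "Ck_on m h2 U"
    and zero: "\<And>i z. i < m \<Longrightarrow> z \<in> U \<Longrightarrow> frechet_derivative (\<phi> i) (at z) (h2 z) = 0"
    and nonzero: "\<And>z. z \<in> U \<Longrightarrow> frechet_derivative (\<phi> m) (at z) (h2 z) \<noteq> 0"
  shows "det (jacobian \<sigma> (at x)) \<noteq> 0"
proof
  let ?J = "jacobian \<sigma> (at x)"
  assume "det ?J = 0"
  then have "\<not> invertible (transpose ?J)"
    by (simp add: invertible_det_nz)
  then have "\<not> (\<exists>B. B ** transpose ?J = mat 1)"
    by (metis invertible_def matrix_left_right_inverse)
  then obtain c where c: "transpose ?J *v c = 0" "c \<noteq> 0"
    unfolding matrix_left_invertible_ker by blast
  have "(\<Sum>i\<le>m. c $ e i * frechet_derivative (\<phi> i) (at x) w) = 0" for w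
  proof -
    have "(\<Sum>i\<le>m. c $ e i * frechet_derivative (\<phi> i) (at x) w) = (\<Sum>i\<le>m. c $ e i * (?J *v w) $ e i)"
      by (intro sum.cong) (simp_all add: jacobian_component[OF \<sigma>_diff] \<sigma>)
    also have "\<dots> = (\<Sum>j\<in>UNIV. c $ j * (?J *v w) $ j)"
      by (rule sum.reindex_bij_betw[OF e])
    also have "\<dots> = c \<bullet> (?J *v w)"
      by (simp add: inner_vec_def)
    also have "\<dots> = (transpose ?J *v c) \<bullet> w"
      by (simp add: dot_lmul_matrix)
    finally show ?thesis using c by simp
  qed
  then have "c $ e i = 0" if "i \<le> m" for i
    using iterated_derivatives_independent[OF U \<phi> \<phi>_Suc h1 h2 zero nonzero _ that, where c = "\<lambda>i. c $ e i"]
    by blast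
  then have "c = 0"
    using bij_betw_imp_surj_on[OF e] by (simp add: vec_eq_iff) (metis UNIV_I atMost_iff imageE)
  with c show False by simp
qed

section \<open>Curves\<close>

lemma Ck_curve_on_SucI:
  assumes "\<And>t. t \<in> I \<Longrightarrow> (f has_vector_derivative f' t) (at t within I)" "Ck_curve_on k f' I"
  shows "Ck_curve_on (Suc k) f I"
  using assms by auto

text \<open>A case distinction replaces induction: the definition asks only for some derivative, and
  the one of \<open>f\<close> serves for \<open>g\<close> as well.\<close>

lemma Ck_curve_on_cong:
  assumes "Ck_curve_on k f I" "\<And>t. t \<in> I \<Longrightarrow> f t = g t"
  shows "Ck_curve_on k g I"
proof (cases k)
  case 0
  then show ?thesis using assms by (simp cong: continuous_on_cong)
next
  case (Suc j)
  with assms(1) obtain f' where f': "\<And>t. t \<in> I \<Longrightarrow> (f has_vector_derivative f' t) (at t within I)"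
    "Ck_curve_on j f' I"
    by auto
  have "(g has_vector_derivative f' t) (at t within I)" if "t \<in> I" for t
    by (rule has_vector_derivative_transform[OF that _ f'(1)[OF that]]) (simp add: assms(2))
  with f'(2) Suc show ?thesis by auto
qed

lemma Ck_curve_on_Suc_imp: "Ck_curve_on (Suc k) f I \<Longrightarrow> Ck_curve_on k f I"
proof (induction k arbitrary: f)
  case 0
  then show ?case
    by (auto simp: continuous_on_eq_continuous_within intro: has_vector_derivative_continuous)
next
  case (Suc k)
  then obtain f' where f': "\<forall>t\<in>I. (f has_vector_derivative f' t) (at t within I)" "Ck_curve_on (Suc k) f' I"
    by (subst (asm) (2) Ck_curve_on.simps) blast
  with Suc.IH[OF f'(2)] show ?case by auto
qed

lemma Ck_curve_on_mono:
  assumes "Ck_curve_on k f I" "j \<le> k"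
  shows "Ck_curve_on j f I"
  using assms(2,1) by (induction rule: inc_induct) (use Ck_curve_on_Suc_imp in blast)+

lemma Ck_curve_on_bounded_linear:
  assumes "bounded_linear L" "Ck_curve_on k f I"
  shows "Ck_curve_on k (\<lambda>t. L (f t)) I"
  using assms(2)
proof (induction k arbitrary: f)
  case 0
  then show ?case using assms(1) by (simp add: bounded_linear.continuous_on)
next
  case (Suc k)
  then obtain f' where f': "\<forall>t\<in>I. (f has_vector_derivative f' t) (at t within I)" "Ck_curve_on k f' I"
    by auto
  with Suc.IH[OF f'(2)] show ?case
    by (auto intro!: exI[of _ "\<lambda>t. L (f' t)"] bounded_linear.has_vector_derivative[OF assms(1)])
qed

lemma Ck_curve_on_add:
  assumes "Ck_curve_on k f I" "Ck_curve_on k g I"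
  shows "Ck_curve_on k (\<lambda>t. f t + g t) I"
  using assms
proof (induction k arbitrary: f g)
  case 0
  then show ?case by (simp add: continuous_on_add)
next
  case (Suc k)
  from Suc.prems obtain f' g' where
    "\<forall>t\<in>I. (f has_vector_derivative f' t) (at t within I)" "Ck_curve_on k f' I"
    "\<forall>t\<in>I. (g has_vector_derivative g' t) (at t within I)" "Ck_curve_on k g' I"
    by auto
  with Suc.IH show ?case
    by (auto intro!: exI[of _ "\<lambda>t. f' t + g' t"] has_vector_derivative_add)
qed

text \<open>Stated for normed algebras because both real and complex curves are multiplied
  later.\<close>

lemma Ck_curve_on_mult:
  fixes f g :: "real \<Rightarrow> 'a::real_normed_algebra"
  assumes "Ck_curve_on k f I" "Ck_curve_on k g I"
  shows "Ck_curve_on k (\<lambda>t. f t * g t) I"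
  using assms
proof (induction k arbitrary: f g)
  case 0
  then show ?case by (simp add: continuous_on_mult)
next
  case (Suc k)
  note d = Suc.prems[THEN Ck_curve_on_Suc_imp]
  from Suc.prems obtain f' g' where fg:
    "\<forall>t\<in>I. (f has_vector_derivative f' t) (at t within I)" "Ck_curve_on k f' I"
    "\<forall>t\<in>I. (g has_vector_derivative g' t) (at t within I)" "Ck_curve_on k g' I"
    by auto
  have "Ck_curve_on k (\<lambda>t. f t * g' t + f' t * g t) I"
    by (intro Ck_curve_on_add Suc.IH fg d)
  with fg show ?case
    by (intro Ck_curve_on_SucI[where f' = "\<lambda>t. f t * g' t + f' t * g t"] has_vector_derivative_mult) auto
qed

text \<open>The derivative contains the inverse of \<open>f\<close> again, but only in class
  \<open>k\<close>, which the induction hypothesis supplies.\<close>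

lemma Ck_curve_on_inverse:
  fixes f :: "real \<Rightarrow> complex"
  assumes "Ck_curve_on k f I" "\<And>t. t \<in> I \<Longrightarrow> f t \<noteq> 0"
  shows "Ck_curve_on k (\<lambda>t. inverse (f t)) I"
  using assms(1)
proof (induction k)
  case 0
  then show ?case using assms(2) by (simp add: continuous_on_inverse)
next
  case (Suc k)
  note IH = Suc.IH[OF Ck_curve_on_Suc_imp[OF Suc.prems]]
  from Suc.prems obtain f' where f':
    "\<forall>t\<in>I. (f has_vector_derivative f' t) (at t within I)" "Ck_curve_on k f' I"
    by auto
  have "Ck_curve_on k (\<lambda>t. - (inverse (f t) * f' t * inverse (f t))) I"
    by (intro Ck_curve_on_bounded_linear[of uminus] Ck_curve_on_mult IH f' bounded_linear_minus
        bounded_linear_ident)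
  moreover have "((\<lambda>t. inverse (f t)) has_vector_derivative - (inverse (f t) * f' t * inverse (f t)))
      (at t within I)" if "t \<in> I" for t
  proof -
    have "((\<lambda>s. inverse (f s)) has_derivative (\<lambda>h. - (inverse (f t) * (h *\<^sub>R f' t) * inverse (f t))))
        (at t within I)"
      using f'(1) that assms(2)
      by (intro Deriv.has_derivative_inverse) (auto simp: has_vector_derivative_def)
    then show ?thesis by (simp add: has_vector_derivative_def)
  qed
  ultimately show ?case by (rule Ck_curve_on_SucI[rotated])
qed

lemma Ck_curve_on_exp:
  fixes f :: "real \<Rightarrow> real"
  assumes "Ck_curve_on k f I"
  shows "Ck_curve_on k (\<lambda>t. exp (f t)) I"
  using assms
proof (induction k)
  case 0
  then show ?case by (simp add: continuous_on_exp)
next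
  case (Suc k)
  note IH = Suc.IH[OF Ck_curve_on_Suc_imp[OF Suc.prems]]
  from Suc.prems obtain f' where f':
    "\<forall>t\<in>I. (f has_vector_derivative f' t) (at t within I)" "Ck_curve_on k f' I"
    by auto
  have "Ck_curve_on k (\<lambda>t. exp (f t) * f' t) I"
    by (intro Ck_curve_on_mult IH f')
  moreover have "((\<lambda>t. exp (f t)) has_vector_derivative exp (f t) * f' t) (at t within I)"
    if "t \<in> I" for t
    using f'(1) that unfolding has_real_derivative_iff_has_vector_derivative[symmetric]
    by (auto intro!: derivative_eq_intros)
  ultimately show ?case by (rule Ck_curve_on_SucI[rotated])
qed

section \<open>Antiderivatives and logarithms along curves on the half-line\<close>

lemma antiderivative_halfline:
  fixes f :: "real \<Rightarrow> 'a::banach"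
  assumes "continuous_on {0..} f"
  shows "t \<ge> 0 \<Longrightarrow> ((\<lambda>t. integral {0..t} f) has_vector_derivative f t) (at t within {0..})"
proof -
  assume t: "t \<ge> 0"
  have "((\<lambda>t. integral {0..t} f) has_vector_derivative f t) (at t within {0..t + 1})"
    by (rule integral_has_vector_derivative) (use assms t in \<open>auto intro: continuous_on_subset\<close>)
  \<comment> \<open>The fundamental theorem is available on compact intervals;
    \<open>{0..t + 1}\<close> coincides with the half-line near \<open>t\<close>.\<close>
  moreover have "at t within {0..t + 1} = at t within {0..}"
    by (rule at_within_nhd[of t "{..<t + 1}"]) auto
  ultimately show ?thesis by simp
qed

text \<open>Writing the velocity as \<open>exp g\<close> yields a speed and a steering angle as smooth as the velocity.\<close>

lemma complex_curve_logarithm: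
  fixes w :: "real \<Rightarrow> complex"
  assumes w: "Ck_curve_on (Suc k) w {0..}" and nz: "\<And>t. t \<ge> 0 \<Longrightarrow> w t \<noteq> 0"
  obtains g where "Ck_curve_on (Suc k) g {0..}" "\<And>t. t \<ge> 0 \<Longrightarrow> exp (g t) = w t"
proof -
  obtain w' where w': "\<And>t. t \<ge> 0 \<Longrightarrow> (w has_vector_derivative w' t) (at t within {0..})"
    "Ck_curve_on k w' {0..}"
    using w by auto
  \<comment> \<open>The logarithmic derivative of \<open>w\<close> is one order less smooth than
    \<open>w\<close>; integration restores that order.\<close>
  define q where "q t = w' t * inverse (w t)" for t
  have q: "Ck_curve_on k q {0..}"
    unfolding q_def
    by (intro Ck_curve_on_mult w' Ck_curve_on_inverse Ck_curve_on_Suc_imp[OF w]) (use nz in auto)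
  \<comment> \<open>\<open>Ln\<close> fixes the initial value only. Along the curve the logarithm is
    continued by integration, so the branch cut of \<open>Ln\<close> does not interfere.\<close>
  define g where "g t = Ln (w 0) + integral {0..t} q" for t
  have cont: "continuous_on {0..} q"
    using Ck_curve_on_mono[OF q, of 0] by simp
  have g': "(g has_vector_derivative q t) (at t within {0..})" if "t \<ge> 0" for t
    using has_vector_derivative_add[OF has_vector_derivative_const antiderivative_halfline[OF cont that]]
    unfolding g_def by simp
  \<comment> \<open>The quotient of \<open>w\<close> by \<open>exp g\<close> is constant, and it is
    1 at time 0 by the choice of the initial value.\<close>
  have "((\<lambda>t. w t * exp (- g t)) has_vector_derivative 0) (at t within {0..})" if "t \<ge> 0" for t
  proof -
    have "((\<lambda>t. exp (- g t)) has_vector_derivative (- q t) * exp (- g t)) (at t within {0..})"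
      using field_vector_diff_chain_within[OF has_vector_derivative_minus[OF g'[OF that]]
          has_field_derivative_at_within[OF DERIV_exp]]
      by (simp add: o_def)
    from has_vector_derivative_mult[OF w'(1)[OF that] this]
    have "((\<lambda>t. w t * exp (- g t)) has_vector_derivative
        w t * (- q t * exp (- g t)) + w' t * exp (- g t)) (at t within {0..})" .
    moreover have "w t * (- q t * exp (- g t)) + w' t * exp (- g t) = 0"
      using nz[OF that] by (simp add: q_def)
    ultimately show ?thesis by simp
  qed
  then have "((\<lambda>t. w t * exp (- g t)) has_vector_derivative 0) (at t within {0..})" if "t \<in> {0..}" for t
    using that by simp
  from has_vector_derivative_zero_constant[OF convex_real_interval(1) this]
  obtain c where c: "\<And>t. t \<in> {0..} \<Longrightarrow> w t * exp (- g t) = c"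
    by blast
  have "c = 1"
    using c[of 0] nz[of 0] by (simp add: g_def exp_minus)
  with c have "exp (g t) = w t" if "t \<ge> 0" for t
    using that by (simp add: exp_minus field_simps)
  moreover have "Ck_curve_on (Suc k) g {0..}"
    by (rule Ck_curve_on_SucI[OF g' q]) simp
  ultimately show ?thesis using that by blast
qed

text \<open>No point of the half-line is isolated in it, so the derivative hidden in the existential
  of \<open>Ck_curve_on\<close> is unique and equals \<open>vector_derivative\<close>. This gives a
  canonical derivative that can be iterated.\<close>

lemma Ck_curve_on_vector_derivative:
  assumes "Ck_curve_on (Suc k) f {0..}"
  shows "Ck_curve_on k (\<lambda>t. vector_derivative f (at t within {0..})) {0..}"
    and "t \<ge> 0 \<Longrightarrow> (f has_vector_derivative vector_derivative f (at t within {0..})) (at t within {0..})"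
proof -
  obtain f' where f': "\<And>t. t \<ge> 0 \<Longrightarrow> (f has_vector_derivative f' t) (at t within {0..})"
    "Ck_curve_on k f' {0..}"
    using assms by auto
  have "at t within {0..} \<noteq> bot" if "t \<ge> 0" for t :: real
  proof
    assume bot: "at t within {0..} = bot"
    have "{t<..} \<subseteq> {0..}" using that by auto
    from at_le[OF this, of t] have "at_right t = bot" by (simp add: bot bot_unique)
    then show False by simp
  qed
  then have eq: "vector_derivative f (at t within {0..}) = f' t" if "t \<ge> 0" for t
    using that f'(1) vector_derivative_within by blast
  show "Ck_curve_on k (\<lambda>t. vector_derivative f (at t within {0..})) {0..}"
    by (rule Ck_curve_on_cong[OF f'(2)]) (simp add: eq)
  show "t \<ge> 0 \<Longrightarrow> (f has_vector_derivative vector_derivative f (at t within {0..})) (at t within {0..})"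
    using f'(1) by (simp add: eq)
qed

section \<open>Recovering a velocity from its image under a derivative\<close>

text \<open>Not the inverse function theorem: continuity of the curve \<open>\<xi>\<close> is given, so an injective
  derivative at the single point suffices.\<close>

lemma has_derivative_cancel_left:
  fixes \<sigma> :: "'a::euclidean_space \<Rightarrow> 'b::euclidean_space" and \<xi> :: "real \<Rightarrow> 'a"
  assumes \<sigma>: "(\<sigma> has_derivative D) (at (\<xi> t))" and "inj D"
    and cont: "continuous (at t within I) \<xi>"
    and der: "((\<lambda>t. \<sigma> (\<xi> t)) has_vector_derivative D w) (at t within I)"
  shows "(\<xi> has_vector_derivative w) (at t within I)"
proof -
  have "linear D" using \<sigma> by (rule has_derivative_linear)
  then obtain B where B: "B > 0" "\<And>x. B * norm x \<le> norm (D x)"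
    using linear_inj_bounded_below_pos[OF _ \<open>inj D\<close>] by metis
  have "\<forall>\<^sub>F s in at t within I. norm (\<xi> s - \<xi> t - (s - t) *\<^sub>R w) \<le> \<epsilon> * norm (s - t)" if "\<epsilon> > 0" for \<epsilon>
  proof -
    \<comment> \<open>Adding 1 permits division by \<open>N\<close> also if \<open>w\<close> is
      zero.\<close>
    define N where "N = norm w + 1"
    have nw: "N > 0" "norm w \<le> N" by (auto simp: N_def add_nonneg_pos)
    \<comment> \<open>The bound \<open>B / 2\<close> allows half of \<open>B * norm y\<close> to be
      absorbed on the left at the end; the other bound makes the contribution of \<open>w\<close> at
      most a quarter of \<open>\<epsilon> * B\<close>.\<close>
    define \<delta> where "\<delta> = min (B / 2) (\<epsilon> * B / (4 * N))"
    have "\<delta> > 0"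
      using that B(1) nw by (simp add: \<delta>_def)
    moreover have "\<delta> \<le> B / 2"
      unfolding \<delta>_def by (rule min.cobounded1)
    ultimately have \<delta>: "\<delta> > 0" "\<delta> \<le> B / 2" .
    have "\<delta> * norm w \<le> \<epsilon> * B / (4 * N) * N"
      unfolding \<delta>_def by (intro mult_mono min.cobounded2) (use that B(1) nw in auto)
    also have "\<dots> = \<epsilon> * B / 4" using nw by simp
    finally have \<delta>w: "\<delta> * norm w \<le> \<epsilon> * B / 4" .
    obtain d where d: "d > 0" "\<And>z. norm (z - \<xi> t) < d \<Longrightarrow>
        norm (\<sigma> z - \<sigma> (\<xi> t) - D (z - \<xi> t)) \<le> \<delta> * norm (z - \<xi> t)"
      using \<sigma> \<delta>(1) unfolding has_derivative_at_alt by blast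
    have "\<forall>\<^sub>F s in at t within I. norm (\<xi> s - \<xi> t) < d"
      using cont d(1) unfolding continuous_within tendsto_iff dist_norm by blast
    moreover have "\<forall>\<^sub>F s in at t within I.
        norm (\<sigma> (\<xi> s) - \<sigma> (\<xi> t) - (s - t) *\<^sub>R D w) \<le> \<epsilon> * B / 4 * norm (s - t)"
    proof -
      have "\<epsilon> * B / 4 > 0" using that B(1) by simp
      then show ?thesis
        using der unfolding has_vector_derivative_def has_derivative_within_alt2 by blast
    qed
    ultimately show ?thesis
    proof eventually_elim
      case (elim s)
      \<comment> \<open>\<open>y\<close> is the linearization error of \<open>\<xi>\<close>. Its
        image under \<open>D\<close> is the error of the composition minus the error of
        \<open>\<sigma>\<close>, both of which are small, and \<open>D\<close> is bounded
        below.\<close>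
      define y where "y = \<xi> s - \<xi> t - (s - t) *\<^sub>R w"
      have Dy: "D y = (\<sigma> (\<xi> s) - \<sigma> (\<xi> t) - (s - t) *\<^sub>R D w) - (\<sigma> (\<xi> s) - \<sigma> (\<xi> t) - D (\<xi> s - \<xi> t))"
        by (simp add: y_def linear_diff[OF \<open>linear D\<close>] linear_cmul[OF \<open>linear D\<close>])
      have "norm (\<xi> s - \<xi> t) \<le> norm y + norm (s - t) * norm w"
        using norm_triangle_ineq[of y "(s - t) *\<^sub>R w"] by (simp add: y_def)
      then have "\<delta> * norm (\<xi> s - \<xi> t) \<le> \<delta> * (norm y + norm (s - t) * norm w)"
        using \<delta>(1) by (simp add: mult_left_mono)
      also have "\<dots> \<le> B / 2 * norm y + norm (s - t) * (\<epsilon> * B / 4)"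
        using mult_right_mono[OF \<delta>(2) norm_ge_zero[of y]]
          mult_left_mono[OF \<delta>w norm_ge_zero[of "s - t"]] by (simp add: algebra_simps)
      finally have *: "\<delta> * norm (\<xi> s - \<xi> t) \<le> B / 2 * norm y + norm (s - t) * (\<epsilon> * B / 4)" .
      have "B * norm y \<le> norm (D y)" by (rule B)
      also have "\<dots> \<le> \<epsilon> * B / 4 * norm (s - t) + \<delta> * norm (\<xi> s - \<xi> t)"
        unfolding Dy by (rule norm_triangle_le_diff) (intro add_mono elim(2) d(2)[OF elim(1)])
      finally have "B * norm y \<le> B * (\<epsilon> * norm (s - t))"
        using * by (simp add: algebra_simps)
      then show ?case using B(1) unfolding y_def[symmetric] by simp
    qed
  qed
  then show ?thesis
    unfolding has_vector_derivative_def has_derivative_within_alt2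
    by (simp add: bounded_linear_scaleR_left)
qed

section \<open>Chained states along an admissible trajectory\<close>

text \<open>Each next state is the previous one differentiated with respect to arc length.\<close>

lemma admissible_chained_solution:
  fixes x :: "real \<Rightarrow> real ^ 2"
  assumes adm: "admissible n x" and "n > 0"
  obtains r :: "real \<Rightarrow> real" and \<sigma> :: "nat \<Rightarrow> real \<Rightarrow> real" where
    "continuous_on {0..} r" "\<And>i. i \<le> n \<Longrightarrow> continuous_on {0..} (\<sigma> i)"
    "\<And>t. t \<ge> 0 \<Longrightarrow> ((\<lambda>t. x t $ 1) has_real_derivative r t * cos (\<sigma> 0 t)) (at t within {0..})"
    "\<And>t. t \<ge> 0 \<Longrightarrow> ((\<lambda>t. x t $ 2) has_real_derivative r t * sin (\<sigma> 0 t)) (at t within {0..})"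
    "\<And>t i. t \<ge> 0 \<Longrightarrow> i < n \<Longrightarrow>
      (\<sigma> i has_real_derivative r t * \<sigma> (Suc i) t) (at t within {0..})"
proof -
  define x' where "x' t = vector_derivative x (at t within {0..})" for t
  have x: "Ck_curve_on (Suc n) x {0..}"
    using adm by (simp add: admissible_def)
  note x' = Ck_curve_on_vector_derivative[OF x, folded x'_def]
  \<comment> \<open>Identifying the plane with the complex numbers makes polar coordinates of the
    velocity the real and imaginary parts of a logarithm \<open>g\<close>: \<open>Re g\<close> is
    the logarithm of the speed and \<open>Im g\<close> the steering angle.\<close>
  define L :: "real ^ 2 \<Rightarrow> complex" where "L v = Complex (v $ 1) (v $ 2)" for v
  have "linear L"
    by (rule linearI) (simp_all add: L_def complex_eq_iff)
  then have L: "bounded_linear L"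
    by (simp add: linear_conv_bounded_linear)
  have nz: "L (x' t) \<noteq> 0" if "t \<ge> 0" for t
  proof
    assume "L (x' t) = 0"
    then have "x' t = 0"
      by (simp add: L_def complex_eq_iff vec_eq_iff forall_2)
    moreover have "bdd_below ((\<lambda>t. norm (x' t)) ` {0..})"
      by (rule bdd_belowI2) (rule norm_ge_zero)
    ultimately have "(INF t\<in>{0..}. norm (x' t)) \<le> 0"
      using cINF_lower[of "\<lambda>t. norm (x' t)" "{0..}" t] that
      by simp
    then show False
      using adm by (simp add: admissible_def x'_def)
  qed
  obtain k where k: "n = Suc k"
    using \<open>n > 0\<close> gr0_implies_Suc by blast
  obtain g where g: "Ck_curve_on n g {0..}" "\<And>t. t \<ge> 0 \<Longrightarrow> exp (g t) = L (x' t)"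
    using complex_curve_logarithm[OF Ck_curve_on_bounded_linear[OF L x'(1)[unfolded k]] nz]
    unfolding k by blast
  \<comment> \<open>\<open>exp (- Re (g t))\<close> is the reciprocal of the speed, so
    \<open>T\<close> is differentiation with respect to arc length.\<close>
  define T where "T f t = exp (- Re (g t)) * vector_derivative f (at t within {0..})"
    for f :: "real \<Rightarrow> real" and t
  define \<sigma> where "\<sigma> i = (T ^^ i) (\<lambda>t. Im (g t))" for i
  have Re: "Ck_curve_on n (\<lambda>t. Re (g t)) {0..}" and Im: "Ck_curve_on n (\<lambda>t. Im (g t)) {0..}"
    by (rule Ck_curve_on_bounded_linear[OF bounded_linear_Re g(1)]
        Ck_curve_on_bounded_linear[OF bounded_linear_Im g(1)])+
  have r: "Ck_curve_on n (\<lambda>t. exp (- Re (g t))) {0..}"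
    by (intro Ck_curve_on_exp Ck_curve_on_bounded_linear[OF _ Re] bounded_linear_minus bounded_linear_ident)
  \<comment> \<open>The angle has class \<open>n\<close> and each application of \<open>T\<close>
    costs one order, so \<open>\<sigma> n\<close> is still continuous.\<close>
  have \<sigma>: "Ck_curve_on (n - i) (\<sigma> i) {0..}" if "i \<le> n" for i
    using that
  proof (induction i)
    case 0
    then show ?case using Im by (simp add: \<sigma>_def)
  next
    case (Suc i)
    then have "Ck_curve_on (Suc (n - Suc i)) (\<sigma> i) {0..}"
      by (simp add: Suc_diff_Suc)
    note Ck_curve_on_vector_derivative(1)[OF this]
    moreover have "Ck_curve_on (n - Suc i) (\<lambda>t. exp (- Re (g t))) {0..}"
      by (rule Ck_curve_on_mono[OF r]) simp
    ultimately have "Ck_curve_on (n - Suc i) (T (\<sigma> i)) {0..}"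
      unfolding T_def by (intro Ck_curve_on_mult)
    then show ?case by (simp add: \<sigma>_def)
  qed
  show ?thesis
  proof (rule that[of "\<lambda>t. exp (Re (g t))" \<sigma>])
    show "continuous_on {0..} (\<lambda>t. exp (Re (g t)))"
      using Ck_curve_on_mono[OF Re, of 0] by (simp add: continuous_on_exp)
    show "continuous_on {0..} (\<sigma> i)" if "i \<le> n" for i
      using Ck_curve_on_mono[OF \<sigma>[OF that], of 0] by simp
    fix t :: real assume t: "t \<ge> 0"
    have "Re (exp (g t)) = x' t $ 1" "Im (exp (g t)) = x' t $ 2"
      using g(2)[OF t] by (simp_all add: L_def)
    then have e: "exp (Re (g t)) * cos (\<sigma> 0 t) = x' t $ 1" "exp (Re (g t)) * sin (\<sigma> 0 t) = x' t $ 2"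
      by (simp_all add: Re_exp Im_exp \<sigma>_def)
    show "((\<lambda>t. x t $ 1) has_real_derivative exp (Re (g t)) * cos (\<sigma> 0 t)) (at t within {0..})"
      "((\<lambda>t. x t $ 2) has_real_derivative exp (Re (g t)) * sin (\<sigma> 0 t)) (at t within {0..})"
      unfolding e has_real_derivative_iff_has_vector_derivative
      by (rule bounded_linear.has_vector_derivative[OF bounded_linear_vec_nth x'(2)[OF t]])+
    show "(\<sigma> i has_real_derivative exp (Re (g t)) * \<sigma> (Suc i) t) (at t within {0..})" if "i < n" for i
    proof -
      have "Ck_curve_on (Suc (n - Suc i)) (\<sigma> i) {0..}"
        using \<sigma>[of i] that by (simp add: Suc_diff_Suc)
      note Ck_curve_on_vector_derivative(2)[OF this t]
      then show ?thesis
        by (simp add: \<sigma>_def T_def exp_minus mult.assoc[symmetric] has_real_derivative_iff_has_vector_derivative)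
    qed
  qed
qed

section \<open>Functions and vector fields in charts\<close>

lemma
  assumes "is_chart c"
  shows open_chart_domain: "open (fst c)"
    and chart_inv_left: "p \<in> fst c \<Longrightarrow> chart_inv c (snd c p) = p"
    and continuous_on_chart: "continuous_on (fst c) (snd c)"
  using assms unfolding is_chart_def homeomorphism_def by auto

lemma open_chart_image:
  assumes "is_chart c" "open W"
  shows "open (snd c ` (fst c \<inter> W))"
proof -
  have "homeomorphism (fst c) (snd c ` fst c) (snd c) (chart_inv c)" "open (snd c ` fst c)"
    using assms(1) by (auto simp: is_chart_def)
  moreover have "openin (top_of_set (fst c)) (fst c \<inter> W)"
    using assms(2) by (rule openin_open_Int)
  ultimately show ?thesis
    using homeomorphism_imp_open_map openin_open_trans by blast
qed

lemma smoothly_compatible_sym: "smoothly_compatible c d \<Longrightarrow> smoothly_compatible d c"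
  by (simp add: smoothly_compatible_def Int_commute)

lemma smoothly_compatible_imp_Ck_on:
  "smoothly_compatible c d \<Longrightarrow> Ck_on k (snd d \<circ> chart_inv c) (snd c ` (fst c \<inter> fst d))"
  by (auto simp: smoothly_compatible_def smooth_on_def)

lemma smoothly_compatible_differentiable:
  assumes "smoothly_compatible c d" "p \<in> fst c" "p \<in> fst d"
  shows "(snd d \<circ> chart_inv c) differentiable (at (snd c p))"
  using smoothly_compatible_imp_Ck_on[OF assms(1), of 1] assms(2,3) by auto

lemma Ck_on_manifold_mono: "Ck_on_manifold A k f D \<Longrightarrow> j \<le> k \<Longrightarrow> Ck_on_manifold A j f D"
  unfolding Ck_on_manifold_def using Ck_on_mono by blast

lemma Ck_vector_field_mono: "Ck_vector_field A k h \<Longrightarrow> j \<le> k \<Longrightarrow> Ck_vector_field A j h"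
  unfolding Ck_vector_field_def using Ck_on_mono by blast

lemma Ck_vector_field_imp_Ck_on:
  "Ck_vector_field A k h \<Longrightarrow> c \<in> A \<Longrightarrow> Ck_on k (h c \<circ> chart_inv c) (snd c ` (fst c \<inter> D))"
  unfolding Ck_vector_field_def by (meson Ck_on_subset Int_lower1 image_mono)

lemma Ck_on_manifold_imp_Ck_on:
  "Ck_on_manifold A k f D \<Longrightarrow> c \<in> A \<Longrightarrow> Ck_on k (f \<circ> chart_inv c) (snd c ` (fst c \<inter> D))"
  by (simp add: Ck_on_manifold_def)

lemma Ck_on_manifold_differentiable:
  "Ck_on_manifold A (Suc k) f D \<Longrightarrow> c \<in> A \<Longrightarrow> p \<in> fst c \<Longrightarrow> p \<in> D \<Longrightarrow>
    (f \<circ> chart_inv c) differentiable (at (snd c p))"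
  unfolding Ck_on_manifold_def by auto

lemma Ck_on_manifold_imp_continuous_on:
  assumes "smooth_manifold Y A" "open D" "D \<subseteq> Y" "Ck_on_manifold A k f D"
  shows "continuous_on D f"
proof (rule continuous_at_imp_continuous_on, rule ballI)
  fix p assume "p \<in> D"
  then obtain c where c: "c \<in> A" "p \<in> fst c" "is_chart c"
    using assms(1,3) by (force simp: smooth_manifold_def)
  have "continuous_on (fst c \<inter> D) ((f \<circ> chart_inv c) \<circ> snd c)"
  proof (rule continuous_on_compose)
    show "continuous_on (fst c \<inter> D) (snd c)"
      using continuous_on_chart[OF c(3)] by (rule continuous_on_subset) auto
    show "continuous_on (snd c ` (fst c \<inter> D)) (f \<circ> chart_inv c)"
      by (rule Ck_on_imp_continuous_on[OF Ck_on_manifold_imp_Ck_on[OF assms(4) c(1)]])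
  qed
  then have "continuous_on (fst c \<inter> D) f"
    by (rule continuous_on_cong[THEN iffD1, rotated -1]) (auto simp: chart_inv_left[OF c(3)])
  moreover have "open (fst c \<inter> D)"
    using assms(2) open_chart_domain[OF c(3)] by blast
  ultimately show "isCont f p"
    using \<open>p \<in> D\<close> c(2) by (simp add: continuous_on_eq_continuous_at)
qed

text \<open>The definition selects some chart \<open>d\<close> around \<open>p\<close>. The chain
  rule through the transition map from \<open>c\<close> to \<open>d\<close>, together with the
  transformation law of \<open>h\<close>, moves the expression to the given chart
  \<open>c\<close>.\<close>

lemma lie_derivative_in_chart:
  assumes A: "smooth_manifold Y A" and h: "Ck_vector_field A k h"
    and f: "Ck_on_manifold A (Suc j) f D"
    and c: "c \<in> A" "p \<in> fst c" "p \<in> D"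
  shows "lie_derivative A h f p = frechet_derivative (f \<circ> chart_inv c) (at (snd c p)) (h c p)"
proof -
  define d where "d = (SOME c. c \<in> A \<and> p \<in> fst c)"
  have d: "d \<in> A" "p \<in> fst d"
    using someI[of "\<lambda>c. c \<in> A \<and> p \<in> fst c" c] c unfolding d_def by auto
  have cd: "is_chart c" "is_chart d" "smoothly_compatible c d"
    using A c d by (auto simp: smooth_manifold_def)
  let ?\<tau> = "snd d \<circ> chart_inv c"
  have inv: "chart_inv c (snd c p) = p"
    using chart_inv_left[OF cd(1)] c(2) .
  have "(?\<tau> has_derivative frechet_derivative ?\<tau> (at (snd c p))) (at (snd c p))"
    using smoothly_compatible_differentiable[OF cd(3) c(2) d(2)] frechet_derivative_works by blast
  moreover have "((f \<circ> chart_inv d) has_derivative frechet_derivative (f \<circ> chart_inv d) (at (snd d p)))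
      (at (?\<tau> (snd c p)))"
    using Ck_on_manifold_differentiable[OF f d c(3)] frechet_derivative_works inv by auto
  ultimately have "(((f \<circ> chart_inv d) \<circ> ?\<tau>) has_derivative
      frechet_derivative (f \<circ> chart_inv d) (at (snd d p)) \<circ> frechet_derivative ?\<tau> (at (snd c p)))
      (at (snd c p))"
    by (rule diff_chain_at)
  then have "((f \<circ> chart_inv c) has_derivative
      frechet_derivative (f \<circ> chart_inv d) (at (snd d p)) \<circ> frechet_derivative ?\<tau> (at (snd c p)))
      (at (snd c p))"
  proof (rule has_derivative_transform_within_open)
    show "open (snd c ` (fst c \<inter> fst d))"
      by (rule open_chart_image[OF cd(1) open_chart_domain[OF cd(2)]])
  qed (use c d in \<open>auto simp: chart_inv_left[OF cd(1)] chart_inv_left[OF cd(2)]\<close>)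
  from fun_cong[OF frechet_derivative_at[OF this], of "h c p"]
  have "frechet_derivative (f \<circ> chart_inv c) (at (snd c p)) (h c p) =
      frechet_derivative (f \<circ> chart_inv d) (at (snd d p)) (frechet_derivative ?\<tau> (at (snd c p)) (h c p))"
    unfolding o_apply[of "frechet_derivative _ _"] by (rule sym)
  also have "frechet_derivative ?\<tau> (at (snd c p)) (h c p) = h d p"
    using h c d unfolding Ck_vector_field_def by (metis IntI)
  finally show ?thesis
    by (simp only: lie_derivative_def d_def[symmetric] Let_def)
qed

text \<open>In each chart this is a derivative along a vector field, which costs one order of
  \<open>f\<close> and none of \<open>h\<close>.\<close>

lemma Ck_on_lie_derivative:
  assumes A: "smooth_manifold Y A" and D: "open D"
    and f: "Ck_on_manifold A (Suc k) f D" and h: "Ck_vector_field A k h"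
  shows "Ck_on_manifold A k (lie_derivative A h f) D"
  unfolding Ck_on_manifold_def
proof
  fix c assume c: "c \<in> A"
  then have ch: "is_chart c"
    using A by (auto simp: smooth_manifold_def)
  have U: "open (snd c ` (fst c \<inter> D))"
    by (rule open_chart_image[OF ch D])
  have "Ck_on k (\<lambda>x. frechet_derivative (f \<circ> chart_inv c) (at x) ((h c \<circ> chart_inv c) x))
      (snd c ` (fst c \<inter> D))"
    by (rule Ck_on_directional_derivative[OF U Ck_on_manifold_imp_Ck_on[OF f c]
          Ck_vector_field_imp_Ck_on[OF h c]])
  then show "Ck_on k (lie_derivative A h f \<circ> chart_inv c) (snd c ` (fst c \<inter> D))"
    by (rule Ck_on_cong[OF U, THEN iffD1, rotated])
      (auto simp: chart_inv_left[OF ch] lie_derivative_in_chart[OF A h f c])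
qed

text \<open>Near each point \<open>y1\<close> is component \<open>k\<close> of a product chart
  compatible with \<open>A\<close>. In a chart \<open>d\<close> of \<open>A\<close> it is therefore
  a component of a smooth transition map.\<close>

lemma split_coordinate_smooth:
  assumes A: "smooth_manifold Y A" and D: "open D"
    and split: "splits_as_line_times A D k y1 z Q"
  shows "Ck_on_manifold A j y1 D"
  unfolding Ck_on_manifold_def
proof
  fix d assume d: "d \<in> A"
  then have dch: "is_chart d"
    using A by (auto simp: smooth_manifold_def)
  obtain g where g: "homeomorphism D (UNIV \<times> Q) (\<lambda>p. (y1 p, z p)) g"
    using split unfolding splits_as_line_times_def by blast
  show "Ck_on j (y1 \<circ> chart_inv d) (snd d ` (fst d \<inter> D))"
  proof (rule Ck_on_locally)
    fix x assume "x \<in> snd d ` (fst d \<inter> D)"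
    then obtain p where p: "p \<in> fst d" "p \<in> D" "x = snd d p" by blast
    have "(y1 p, z p) \<in> UNIV \<times> Q"
      using homeomorphism_image1[OF g] p(2) by blast
    then have "z p \<in> Q" by simp
    then obtain V and \<psi> :: "'c \<Rightarrow> real ^ 'b" where V: "z p \<in> V"
      "let c = ({p \<in> D. z p \<in> V}, \<lambda>p. \<chi> j. if j = k then y1 p else \<psi> (z p) $ j)
         in is_chart c \<and> (\<forall>d\<in>A. smoothly_compatible c d)"
      using split unfolding splits_as_line_times_def by blast
    define c where "c = ({p \<in> D. z p \<in> V}, \<lambda>p. \<chi> j. if j = k then y1 p else \<psi> (z p) $ j)"
    have "is_chart c \<and> (\<forall>d\<in>A. smoothly_compatible c d)"
      using V(2) by (simp add: Let_def c_def)
    then have c: "is_chart c" "smoothly_compatible d c" "p \<in> fst c"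
      using V(1) p d by (auto intro: smoothly_compatible_sym simp: c_def)
    have W: "open (snd d ` (fst d \<inter> fst c))"
      by (rule open_chart_image[OF dch open_chart_domain[OF c(1)]])
    have "Ck_on j (\<lambda>x. (snd c \<circ> chart_inv d) x $ k) (snd d ` (fst d \<inter> fst c))"
      by (rule Ck_on_bounded_linear[OF W bounded_linear_vec_nth smoothly_compatible_imp_Ck_on[OF c(2)]])
    then have "Ck_on j (y1 \<circ> chart_inv d) (snd d ` (fst d \<inter> fst c))"
      by (simp add: c_def o_def)
    then show "\<exists>V. open V \<and> x \<in> V \<and> Ck_on j (y1 \<circ> chart_inv d) V"
      using W p c by blast
  qed
qed

text \<open>Continuity keeps the curve in the domain of \<open>c\<close> near \<open>t\<close>,
  where \<open>f\<close> along the curve factors through the chart and the ordinary chain rule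
  applies.\<close>

lemma has_velocity_chain:
  assumes A: "smooth_manifold Y A" and f: "Ck_on_manifold A (Suc k) f D"
    and v: "has_velocity A y w t I" and t: "t \<in> I" "y t \<in> D"
    and c: "c \<in> A" "y t \<in> fst c"
  shows "((\<lambda>s. f (y s)) has_vector_derivative
    frechet_derivative (f \<circ> chart_inv c) (at (snd c (y t))) (w c)) (at t within I)"
proof -
  let ?D = "frechet_derivative (f \<circ> chart_inv c) (at (snd c (y t)))"
  have ch: "is_chart c"
    using A c by (auto simp: smooth_manifold_def)
  have "((f \<circ> chart_inv c) has_derivative ?D) (at ((snd c \<circ> y) t))"
    using Ck_on_manifold_differentiable[OF f c t(2)] by (simp add: frechet_derivative_works)
  moreover have "((snd c \<circ> y) has_derivative (\<lambda>h. h *\<^sub>R w c)) (at t within I)"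
    using v c by (auto simp: has_velocity_def has_vector_derivative_def)
  ultimately have "((\<lambda>s. (f \<circ> chart_inv c) ((snd c \<circ> y) s)) has_derivative (\<lambda>h. ?D (h *\<^sub>R w c))) (at t within I)"
    using has_derivative_compose by blast
  moreover have "\<forall>\<^sub>F s in at t within I. y s \<in> fst c"
    using v open_chart_domain[OF ch] c(2) unfolding has_velocity_def continuous_within
    by (auto dest: topological_tendstoD)
  then have "\<forall>\<^sub>F s in at t within I. (f \<circ> chart_inv c) ((snd c \<circ> y) s) = f (y s)"
    by eventually_elim (simp add: chart_inv_left[OF ch])
  ultimately have "((\<lambda>s. f (y s)) has_derivative (\<lambda>h. ?D (h *\<^sub>R w c))) (at t within I)"
    by (rule has_derivative_transform_eventually) (use c t in \<open>auto simp: chart_inv_left[OF ch]\<close>)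
  moreover have "?D (h *\<^sub>R w c) = h *\<^sub>R ?D (w c)" for h
    using linear_cmul[OF linear_frechet_derivative[OF Ck_on_manifold_differentiable[OF f c t(2)]]] .
  ultimately show ?thesis
    by (simp add: has_vector_derivative_def)
qed

text \<open>The converse direction of the chain rule: a nonsingular Jacobian has an injective
  derivative, which can be cancelled along a continuous curve.\<close>

lemma chart_velocity_from_image:
  assumes A: "smooth_manifold Y A" and S: "Ck_on_manifold A (Suc k) S D"
    and nonsing: "nonsingular_jacobian_on A S D"
    and y: "continuous (at t within I) y" "t \<in> I" "y t \<in> D"
    and c: "c \<in> A" "y t \<in> fst c"
    and der: "((\<lambda>s. S (y s)) has_vector_derivative
      frechet_derivative (S \<circ> chart_inv c) (at (snd c (y t))) w) (at t within I)"
  shows "((snd c \<circ> y) has_vector_derivative w) (at t within I)"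
proof (rule has_derivative_cancel_left)
  have ch: "is_chart c"
    using A c by (auto simp: smooth_manifold_def)
  note d = Ck_on_manifold_differentiable[OF S c y(3)]
  let ?D = "frechet_derivative (S \<circ> chart_inv c) (at (snd c (y t)))"
  show "((S \<circ> chart_inv c) has_derivative ?D) (at ((snd c \<circ> y) t))"
    using d by (simp add: frechet_derivative_works)
  let ?J = "jacobian (S \<circ> chart_inv c) (at (snd c (y t)))"
  have "det ?J \<noteq> 0"
    using nonsing c y(3) by (simp add: nonsingular_jacobian_on_def)
  then have "inj ((*v) ?J)"
    by (metis invertible_det_nz invertible_def matrix_left_invertible_injective)
  moreover have "?D = (*v) ?J"
    using d[unfolded jacobian_works] frechet_derivative_at by metis
  ultimately show "inj ?D" by simp
  have "isCont (snd c) (y t)"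
    using continuous_on_chart[OF ch] open_chart_domain[OF ch] c(2)
    by (simp add: continuous_on_eq_continuous_at)
  then show "continuous (at t within I) (snd c \<circ> y)"
    using y(1) continuous_within_compose2 continuous_at_imp_continuous_at_within
    by (simp add: continuous_within isCont_tendsto_compose o_def)
  have "\<forall>\<^sub>F s in at t within I. y s \<in> fst c"
    using y(1) open_chart_domain[OF ch] c(2) unfolding continuous_within
    by (auto dest: topological_tendstoD)
  then have "\<forall>\<^sub>F s in at t within I. S (y s) = (S \<circ> chart_inv c) ((snd c \<circ> y) s)"
    by eventually_elim (simp add: chart_inv_left[OF ch])
  then show "((\<lambda>s. (S \<circ> chart_inv c) ((snd c \<circ> y) s)) has_vector_derivative ?D w) (at t within I)"
    unfolding has_vector_derivative_def
    by (intro has_derivative_transform_eventually[OF der[unfolded has_vector_derivative_def]])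
      (use c y in \<open>auto simp: chart_inv_left[OF ch]\<close>)
qed

text \<open>In each chart \<open>S\<close> is a continuous injection between open sets of equal
  dimension, hence open by invariance of domain. Since the charts cover \<open>D\<close>,
  \<open>S\<close> is an open map on \<open>D\<close>, so its inverse is continuous.\<close>

lemma continuous_on_inverse_of_manifold_bijection:
  fixes S :: "'m::topological_space \<Rightarrow> real ^ 'n::finite"
  assumes "\<And>c. c \<in> A \<Longrightarrow> is_chart (c :: ('m, 'n) chart)" and D: "open D" "D \<subseteq> \<Union>(fst ` A)"
    and S: "Ck_on_manifold A k S D" and bij: "bij_betw S D UNIV"
  shows "continuous_on UNIV (inv_into D S)"
proof -
  have "open (S ` W)" if W: "open W" "W \<subseteq> D" for W
  proof -
    have "open ((S \<circ> chart_inv c) ` (snd c ` (fst c \<inter> W)))" if c: "c \<in> A" for c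
    proof (rule invariance_of_domain)
      note ch = assms(1)[OF c]
      show "open (snd c ` (fst c \<inter> W))"
        by (rule open_chart_image[OF ch W(1)])
      show "continuous_on (snd c ` (fst c \<inter> W)) (S \<circ> chart_inv c)"
      proof (rule continuous_on_subset)
        show "continuous_on (snd c ` (fst c \<inter> D)) (S \<circ> chart_inv c)"
          by (rule Ck_on_imp_continuous_on[OF Ck_on_manifold_imp_Ck_on[OF S c]])
      qed (use W in auto)
      show "inj_on (S \<circ> chart_inv c) (snd c ` (fst c \<inter> W))"
        using bij_betw_imp_inj_on[OF bij] W(2) by (auto simp: inj_on_def chart_inv_left[OF ch])
    qed
    moreover have "S ` W = (\<Union>c\<in>A. (S \<circ> chart_inv c) ` (snd c ` (fst c \<inter> W)))"
    proof (intro equalityI subsetI)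
      fix s assume "s \<in> S ` W"
      then obtain p where p: "p \<in> W" "s = S p" by blast
      moreover obtain c where c: "c \<in> A" "p \<in> fst c" using D(2) W(2) p by blast
      ultimately have "s \<in> (S \<circ> chart_inv c) ` (snd c ` (fst c \<inter> W))"
        by (force simp: chart_inv_left[OF assms(1)])
      with c show "s \<in> (\<Union>c\<in>A. (S \<circ> chart_inv c) ` (snd c ` (fst c \<inter> W)))" by blast
    next
      fix s assume "s \<in> (\<Union>c\<in>A. (S \<circ> chart_inv c) ` (snd c ` (fst c \<inter> W)))"
      then obtain c p where "c \<in> A" "p \<in> fst c" "p \<in> W" "s = (S \<circ> chart_inv c) (snd c p)"
        by blast
      then show "s \<in> S ` W" by (simp add: chart_inv_left[OF assms(1)])
    qed
    ultimately show ?thesis by auto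
  qed
  moreover have "inv_into D S -` B = S ` (D \<inter> B)" for B
    using bij by (auto simp: bij_betw_def image_iff inv_into_into f_inv_into_f intro!: bexI[of _ "inv_into D S _"])
  ultimately show ?thesis
    using D(1) by (simp add: continuous_on_open_vimage open_Int)
qed

section \<open>Chained form and maneuverability\<close>

text \<open>The setting of the theorem, with the splitting represented by the smoothness of
  \<open>y1\<close> that it yields.\<close>

locale lie_chain =
  fixes \<Y> \<O> :: "'m::{t2_space, second_countable_topology} set"
    and A :: "('m, 'n::finite) chart set"
    and e :: "nat \<Rightarrow> 'n"
    and y1 :: "'m \<Rightarrow> real"
    and h1 h2 :: "('m, 'n) vfield"
  assumes enum: "bij_betw e {1..CARD('n)} UNIV"
    and manifold: "smooth_manifold \<Y> A"
    and h1: "Ck_vector_field A (CARD('n) - 1) h1"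
    and h2: "Ck_vector_field A (CARD('n) - 1) h2"
    and O_sub: "open \<O>" "\<O> \<subseteq> \<Y>"
    and y1_smooth: "\<And>j. Ck_on_manifold A j y1 \<O>"
    and lie_zero: "\<And>p i. p \<in> \<O> \<Longrightarrow> i + 2 \<le> CARD('n) \<Longrightarrow>
          lie_derivative A h2 ((lie_derivative A h1 ^^ i) y1) p = 0"
    and lie_nonzero: "\<And>p. p \<in> \<O> \<Longrightarrow>
          lie_derivative A h2 ((lie_derivative A h1 ^^ (CARD('n) - 1)) y1) p \<noteq> 0"
begin

abbreviation \<phi> :: "nat \<Rightarrow> 'm \<Rightarrow> real" where
  "\<phi> i \<equiv> (lie_derivative A h1 ^^ i) y1"

abbreviation \<gamma> :: "'m \<Rightarrow> real" where
  "\<gamma> \<equiv> lie_derivative A h2 (\<phi> (CARD('n) - 1))"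

abbreviation S :: "'m \<Rightarrow> real ^ 'n" where
  "S \<equiv> coord_change A e y1 h1"

abbreviation F :: "'m \<Rightarrow> real ^ 2 ^ 2" where
  "F \<equiv> feedback_matrix A y1 h1 h2"

lemma chart: "c \<in> A \<Longrightarrow> is_chart c"
  using manifold by (simp add: smooth_manifold_def)

lemma chart_image_open: "c \<in> A \<Longrightarrow> open (snd c ` (fst c \<inter> \<O>))"
  by (rule open_chart_image[OF chart O_sub(1)])

lemma chart_around: "p \<in> \<O> \<Longrightarrow> \<exists>c\<in>A. p \<in> fst c"
  using manifold O_sub(2) by (auto simp: smooth_manifold_def)

text \<open>Each Lie derivative costs one order. The first one already has class
  \<open>CARD('n) - 1\<close> only, which matches the class of \<open>h1\<close>; the last one is
  just continuous.\<close>

lemma Ck_on_iterated_lie: "i \<le> CARD('n) \<Longrightarrow> Ck_on_manifold A (CARD('n) - i) (\<phi> i) \<O>"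
proof (induction i)
  case 0
  show ?case using y1_smooth by simp
next
  case (Suc i)
  then have "Ck_on_manifold A (Suc (CARD('n) - Suc i)) (\<phi> i) \<O>"
    by (simp add: Suc_diff_Suc)
  then have "Ck_on_manifold A (CARD('n) - Suc i) (lie_derivative A h1 (\<phi> i)) \<O>"
    by (rule Ck_on_lie_derivative[OF manifold O_sub(1)])
      (rule Ck_vector_field_mono[OF h1], simp)
  then show ?case by simp
qed

lemma C1_iterated_lie: "i < CARD('n) \<Longrightarrow> Ck_on_manifold A (Suc 0) (\<phi> i) \<O>"
  by (rule Ck_on_manifold_mono[OF Ck_on_iterated_lie]) auto

lemma lie1_in_chart:
  assumes "i < CARD('n)" "c \<in> A" "p \<in> fst c" "p \<in> \<O>"
  shows "frechet_derivative (\<phi> i \<circ> chart_inv c) (at (snd c p)) (h1 c p) = \<phi> (Suc i) p"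
  using lie_derivative_in_chart[OF manifold h1 C1_iterated_lie[OF assms(1)] assms(2-4)] by simp

lemma lie2_in_chart:
  assumes "i < CARD('n)" "c \<in> A" "p \<in> fst c" "p \<in> \<O>"
  shows "frechet_derivative (\<phi> i \<circ> chart_inv c) (at (snd c p)) (h2 c p) =
    lie_derivative A h2 (\<phi> i) p"
  using lie_derivative_in_chart[OF manifold h2 C1_iterated_lie[OF assms(1)] assms(2-4)] by simp

text \<open>Fixes the shift between components, counted from 1 by \<open>e\<close>, and orders of
  Lie derivatives, counted from 0.\<close>

lemma S_component: "i < CARD('n) \<Longrightarrow> S p $ e (Suc i) = \<phi> i p"
  using bij_betw_imp_inj_on[OF enum] by (simp add: coord_change_def inv_into_f_f)

lemma component_index: "\<exists>i<CARD('n). j = e (Suc i)"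
proof -
  obtain i where "i \<in> {1..CARD('n)}" "j = e i"
    using bij_betw_imp_surj_on[OF enum] by (metis UNIV_I imageE)
  then show ?thesis
    by (intro exI[of _ "i - 1"]) auto
qed

lemma C1_S: "Ck_on_manifold A 1 S \<O>"
  unfolding Ck_on_manifold_def
proof
  fix c assume c: "c \<in> A"
  show "Ck_on 1 (S \<circ> chart_inv c) (snd c ` (fst c \<inter> \<O>))"
  proof (rule Ck_on_vec[OF chart_image_open[OF c]])
    fix j
    obtain i where i: "i < CARD('n)" "j = e (Suc i)" using component_index by blast
    have "(\<lambda>x. (S \<circ> chart_inv c) x $ j) = \<phi> i \<circ> chart_inv c"
      using i by (auto simp: S_component)
    then show "Ck_on 1 (\<lambda>x. (S \<circ> chart_inv c) x $ j) (snd c ` (fst c \<inter> \<O>))"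
      using Ck_on_manifold_imp_Ck_on[OF C1_iterated_lie[OF i(1)] c] by (simp only: One_nat_def)
  qed
qed

lemma S_differentiable:
  "c \<in> A \<Longrightarrow> p \<in> fst c \<Longrightarrow> p \<in> \<O> \<Longrightarrow> (S \<circ> chart_inv c) differentiable (at (snd c p))"
  using Ck_on_manifold_differentiable C1_S by (metis One_nat_def)

lemma nonsingular_S: "nonsingular_jacobian_on A S \<O>"
  unfolding nonsingular_jacobian_on_def
proof (intro ballI)
  fix c p assume c: "c \<in> A" and p: "p \<in> fst c \<inter> \<O>"
  let ?m = "CARD('n) - 1"
  let ?U = "snd c ` (fst c \<inter> \<O>)"
  have m: "Suc ?m = CARD('n)" by simp
  note inv = chart_inv_left[OF chart[OF c]]
  \<comment> \<open>The Euclidean lemma enumerates components from 0, with \<open>m\<close> one less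
    than the dimension, so \<open>e\<close> is composed with \<open>Suc\<close>.\<close>
  have bij: "bij_betw (\<lambda>i. e (Suc i)) {..?m} UNIV"
  proof -
    have "bij_betw Suc {..?m} {1..CARD('n)}"
      using image_Suc_atMost[of ?m] unfolding m by (simp add: bij_betw_def)
    from bij_betw_trans[OF this enum] show ?thesis by (simp add: o_def)
  qed
  show "det (jacobian (S \<circ> chart_inv c) (at (snd c p))) \<noteq> 0"
  proof (rule det_jacobian_iterated_derivatives[where U = ?U and m = ?m and
        e = "\<lambda>i. e (Suc i)" and \<phi> = "\<lambda>i. \<phi> i \<circ> chart_inv c" and
        ?h1.0 = "h1 c \<circ> chart_inv c" and ?h2.0 = "h2 c \<circ> chart_inv c"])
    show "open ?U" by (rule chart_image_open[OF c])
    show "snd c p \<in> ?U" using p by blast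
    show "bij_betw (\<lambda>i. e (Suc i)) {..?m} UNIV" by (rule bij)
    show "(S \<circ> chart_inv c) differentiable at (snd c p)"
      using S_differentiable c p by blast
    show "Ck_on ?m (h1 c \<circ> chart_inv c) ?U" "Ck_on ?m (h2 c \<circ> chart_inv c) ?U"
      by (rule Ck_vector_field_imp_Ck_on[OF h1 c] Ck_vector_field_imp_Ck_on[OF h2 c])+
    fix i
    show "(\<lambda>z. (S \<circ> chart_inv c) z $ e (Suc i)) = \<phi> i \<circ> chart_inv c" if "i \<le> ?m"
    proof -
      from that m have "i < CARD('n)" by linarith
      then show ?thesis by (simp add: S_component o_def)
    qed
    show "Ck_on (Suc ?m - i) (\<phi> i \<circ> chart_inv c) ?U" if "i \<le> ?m"
      unfolding m by (rule Ck_on_manifold_imp_Ck_on[OF Ck_on_iterated_lie c]) (use that in simp)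
    fix x assume "x \<in> ?U"
    then obtain q where q: "q \<in> fst c" "q \<in> \<O>" "x = snd c q" by blast
    show "(\<phi> (Suc i) \<circ> chart_inv c) x =
        frechet_derivative (\<phi> i \<circ> chart_inv c) (at x) ((h1 c \<circ> chart_inv c) x)" if "i < ?m"
      unfolding o_apply[of "\<phi> (Suc i)"] o_apply[of "h1 c"] q(3) inv[OF q(1)] by (rule lie1_in_chart[symmetric]) (use that c q in auto)
    show "frechet_derivative (\<phi> i \<circ> chart_inv c) (at x) ((h2 c \<circ> chart_inv c) x) = 0" if "i < ?m"
      using lie2_in_chart[OF _ c q(1,2), of i] lie_zero[OF q(2), of i] that
      unfolding o_apply[of "h2 c"] q(3) inv[OF q(1)] by linarith
    show "frechet_derivative (\<phi> ?m \<circ> chart_inv c) (at x) ((h2 c \<circ> chart_inv c) x) \<noteq> 0"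
      using lie2_in_chart[OF _ c q(1,2), of ?m] lie_nonzero[OF q(2)]
      unfolding o_apply[of "h2 c"] q(3) inv[OF q(1)] by simp
  qed
qed

section \<open>The feedback matrix\<close>

lemma F_entries:
  "F p $ 1 $ 1 = 1" "F p $ 1 $ 2 = 0" "F p $ 2 $ 1 = \<phi> CARD('n) p" "F p $ 2 $ 2 = \<gamma> p"
  by (simp_all add: feedback_matrix_def)

lemma F_apply: "(F p *v u) $ 1 = u $ 1" "(F p *v u) $ 2 = \<phi> CARD('n) p * u $ 1 + \<gamma> p * u $ 2"
  by (simp_all add: matrix_vector_mult_def sum_2 F_entries)

lemma continuous_on_lie: "continuous_on \<O> (\<phi> CARD('n))" "continuous_on \<O> \<gamma>"
proof -
  show "continuous_on \<O> (\<phi> CARD('n))"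
    by (rule Ck_on_manifold_imp_continuous_on[OF manifold O_sub Ck_on_iterated_lie]) simp
  have "Ck_on_manifold A 0 \<gamma> \<O>"
    by (rule Ck_on_lie_derivative[OF manifold O_sub(1) C1_iterated_lie Ck_vector_field_mono[OF h2]])
      auto
  then show "continuous_on \<O> \<gamma>"
    by (rule Ck_on_manifold_imp_continuous_on[OF manifold O_sub])
qed

lemma continuous_on_F: "continuous_on \<O> F"
proof -
  have "continuous_on \<O> (\<lambda>p. F p $ i $ j)" for i j
    using exhaust_2[of i] exhaust_2[of j] continuous_on_lie by (auto simp: F_entries)
  then have "continuous_on \<O> (\<lambda>p. \<chi> i. \<chi> j. F p $ i $ j)"
    by (intro continuous_on_vec_lambda)
  then show ?thesis by simp
qed

text \<open>The matrix is lower triangular with determinant \<open>\<gamma> p\<close>.\<close>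

lemma invertible_F: "p \<in> \<O> \<Longrightarrow> invertible (F p)"
  using lie_nonzero[of p] by (simp add: invertible_det_nz det_2 F_entries)

section \<open>Equivalence of the two systems\<close>

lemma S_derivative_component:
  assumes "i < CARD('n)" "c \<in> A" "p \<in> fst c" "p \<in> \<O>"
  shows "frechet_derivative (S \<circ> chart_inv c) (at (snd c p)) (a *\<^sub>R h1 c p + b *\<^sub>R h2 c p) $ e (Suc i) =
    a * \<phi> (Suc i) p + b * lie_derivative A h2 (\<phi> i) p"
proof -
  let ?D = "frechet_derivative (\<phi> i \<circ> chart_inv c) (at (snd c p))"
  have "((S \<circ> chart_inv c) has_derivative frechet_derivative (S \<circ> chart_inv c) (at (snd c p))) (at (snd c p))"
    using S_differentiable[OF assms(2-4)] by (simp add: frechet_derivative_works)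
  from bounded_linear.has_derivative[OF bounded_linear_vec_nth this, of "e (Suc i)"]
  have "((\<phi> i \<circ> chart_inv c) has_derivative
      (\<lambda>w. frechet_derivative (S \<circ> chart_inv c) (at (snd c p)) w $ e (Suc i))) (at (snd c p))"
    using assms(1) by (simp add: S_component o_def)
  from frechet_derivative_at[OF this]
  have "frechet_derivative (S \<circ> chart_inv c) (at (snd c p)) w $ e (Suc i) = ?D w" for w
    by (rule fun_cong)
  moreover have "linear ?D"
    by (rule linear_frechet_derivative[OF Ck_on_manifold_differentiable[OF C1_iterated_lie]]) (use assms in auto)
  ultimately show ?thesis
    using lie1_in_chart[OF assms] lie2_in_chart[OF assms]
    by (simp only: linear_add linear_cmul real_scaleR_def)
qed

text \<open>From left to right this is the chain rule; from right to left the nonsingular Jacobian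
  of \<open>S\<close> determines the velocity in every chart.\<close>

lemma velocity_iff:
  assumes y: "continuous_on I y" "y ` I \<subseteq> \<O>" and t: "t \<in> I"
  shows "has_velocity A y (\<lambda>c. a *\<^sub>R h1 c (y t) + b *\<^sub>R h2 c (y t)) t I \<longleftrightarrow>
    (\<forall>i<CARD('n). ((\<lambda>s. S (y s) $ e (Suc i)) has_real_derivative
      a * \<phi> (Suc i) (y t) + b * lie_derivative A h2 (\<phi> i) (y t)) (at t within I))"
    (is "?vel \<longleftrightarrow> ?comp")
proof -
  have yt: "y t \<in> \<O>" using y(2) t by blast
  let ?D = "\<lambda>c. frechet_derivative (S \<circ> chart_inv c) (at (snd c (y t))) (a *\<^sub>R h1 c (y t) + b *\<^sub>R h2 c (y t))"
  have C1: "Ck_on_manifold A (Suc 0) S \<O>" using C1_S by (simp only: One_nat_def)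
  \<comment> \<open>The right-hand side does not mention \<open>c\<close>. One chart therefore
    suffices to obtain it, and it then yields the velocity in all charts around
    \<open>y t\<close>.\<close>
  have comp: "((\<lambda>s. S (y s)) has_vector_derivative ?D c) (at t within I) \<longleftrightarrow> ?comp"
    if c: "c \<in> A" "y t \<in> fst c" for c
  proof
    assume *: "((\<lambda>s. S (y s)) has_vector_derivative ?D c) (at t within I)"
    show ?comp
    proof (intro allI impI)
      fix i assume i: "i < CARD('n)"
      from bounded_linear.has_vector_derivative[OF bounded_linear_vec_nth *, of "e (Suc i)"]
      show "((\<lambda>s. S (y s) $ e (Suc i)) has_real_derivative
          a * \<phi> (Suc i) (y t) + b * lie_derivative A h2 (\<phi> i) (y t)) (at t within I)"
        unfolding has_real_derivative_iff_has_vector_derivative S_derivative_component[OF i c yt] .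
    qed
  next
    assume ?comp
    then have "((\<lambda>s. S (y s) $ j) has_real_derivative ?D c $ j) (at t within I)" for j
      using component_index[of j] S_derivative_component[OF _ c yt] by force
    then have "((\<lambda>s. S (y s) \<bullet> b) has_derivative (\<lambda>h. (h *\<^sub>R ?D c) \<bullet> b)) (at t within I)" if "b \<in> Basis" for b
      using that by (auto simp: Basis_vec_def inner_axis has_field_derivative_def mult.commute[of _ "_ $ _"])
    then show "((\<lambda>s. S (y s)) has_vector_derivative ?D c) (at t within I)"
      unfolding has_vector_derivative_def using has_derivative_componentwise_within by blast
  qed
  obtain c0 where c0: "c0 \<in> A" "y t \<in> fst c0" using chart_around[OF yt] by blast
  show ?thesis
  proof
    assume ?vel
    from has_velocity_chain[OF manifold C1 this t yt c0] show ?comp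
      using comp[OF c0] by blast
  next
    assume ?comp
    have cont: "continuous (at t within I) y"
      using y(1) t by (simp add: continuous_on_eq_continuous_within)
    have "((snd c \<circ> y) has_vector_derivative a *\<^sub>R h1 c (y t) + b *\<^sub>R h2 c (y t)) (at t within I)"
      if c: "c \<in> A" "y t \<in> fst c" for c
      by (rule chart_velocity_from_image[OF manifold C1 nonsingular_S cont t yt c])
        (use comp[OF c] \<open>?comp\<close> in blast)
    then show ?vel
      using c0 cont by (auto simp: has_velocity_def)
  qed
qed

text \<open>By \<open>lie_zero\<close> the second input disappears from all components of the
  velocity of \<open>S\<close> except the last, leaving a chain of integrators. The last component
  is the second row of \<open>F\<close> applied to the input.\<close>

lemma solves_iff:
  assumes y: "continuous_on I y" "y ` I \<subseteq> \<O>"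
  shows "solves_system A y1 h1 h2 I x y u \<longleftrightarrow>
    solves_chained_system e I x (\<lambda>t. S (y t)) (\<lambda>t. F (y t) *v u t)"
proof -
  let ?m = "CARD('n) - 1"
  have m: "Suc ?m = CARD('n)" by simp
  have "has_velocity A y (\<lambda>c. u t $ 1 *\<^sub>R h1 c (y t) + u t $ 2 *\<^sub>R h2 c (y t)) t I \<longleftrightarrow>
      (\<forall>i\<in>{1..<CARD('n)}. ((\<lambda>t. S (y t) $ e i) has_real_derivative
          u t $ 1 * S (y t) $ e (i + 1)) (at t within I)) \<and>
      ((\<lambda>t. S (y t) $ e CARD('n)) has_real_derivative
        \<phi> CARD('n) (y t) * u t $ 1 + \<gamma> (y t) * u t $ 2) (at t within I)"
    if t: "t \<in> I" for t
  proof -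
    have yt: "y t \<in> \<O>" using y(2) t by blast
    let ?P = "\<lambda>i. ((\<lambda>s. S (y s) $ e (Suc i)) has_real_derivative
      u t $ 1 * \<phi> (Suc i) (y t) + u t $ 2 * lie_derivative A h2 (\<phi> i) (y t)) (at t within I)"
    have "(\<forall>i<CARD('n). ?P i) \<longleftrightarrow> (\<forall>i<?m. ?P i) \<and> ?P ?m"
      using All_less_Suc[of ?m ?P] unfolding m by (simp only: conj_commute)
    also have "(\<forall>i<?m. ?P i) \<longleftrightarrow> (\<forall>i<?m. ((\<lambda>t. S (y t) $ e (Suc i)) has_real_derivative
          u t $ 1 * S (y t) $ e (Suc i + 1)) (at t within I))"
    proof (intro all_cong)
      fix i assume "i < ?m"
      then have "lie_derivative A h2 (\<phi> i) (y t) = 0" "S (y t) $ e (Suc i + 1) = \<phi> (Suc i) (y t)"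
        using lie_zero[OF yt, of i] S_component[of "Suc i"] by auto
      then show "?P i \<longleftrightarrow> ((\<lambda>t. S (y t) $ e (Suc i)) has_real_derivative
          u t $ 1 * S (y t) $ e (Suc i + 1)) (at t within I)" by simp
    qed
    also have "\<dots> \<longleftrightarrow> (\<forall>i\<in>{1..<CARD('n)}. ((\<lambda>t. S (y t) $ e i) has_real_derivative
          u t $ 1 * S (y t) $ e (i + 1)) (at t within I))"
      (is "(\<forall>i<?m. ?R (Suc i)) \<longleftrightarrow> _")
    proof -
      have "{1..<CARD('n)} = Suc ` {..<?m}"
        using image_Suc_lessThan[of ?m] atLeastLessThanSuc_atLeastAtMost[of 1 ?m] unfolding m by simp
      then show ?thesis by auto
    qed
    also have "?P ?m \<longleftrightarrow> ((\<lambda>t. S (y t) $ e CARD('n)) has_real_derivative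
        \<phi> CARD('n) (y t) * u t $ 1 + \<gamma> (y t) * u t $ 2) (at t within I)"
      unfolding m by (simp only: mult.commute)
    finally show ?thesis
      unfolding velocity_iff[OF y t] .
  qed
  moreover have "S p $ e 1 = y1 p" for p
    using S_component[of 0] by simp
  ultimately show ?thesis
    unfolding solves_system_def solves_chained_system_def F_apply by simp
qed

section \<open>Maneuverability\<close>

lemma maneuverable_if_bij:
  assumes bij: "bij_betw S \<O> UNIV"
  shows "maneuverable A y1 h1 h2 (UNIV \<times> \<O>)"
  unfolding maneuverable_def
proof (intro allI impI)
  fix x :: "real \<Rightarrow> real ^ 2"
  assume adm: "admissible CARD('n) x"
  obtain r :: "real \<Rightarrow> real" and \<sigma> where
    r: "continuous_on {0..} r" and \<sigma>: "\<And>i. i \<le> CARD('n) \<Longrightarrow> continuous_on {0..} (\<sigma> i)" and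
    x1: "\<And>t. t \<ge> 0 \<Longrightarrow> ((\<lambda>t. x t $ 1) has_real_derivative r t * cos (\<sigma> 0 t)) (at t within {0..})" and
    x2: "\<And>t. t \<ge> 0 \<Longrightarrow> ((\<lambda>t. x t $ 2) has_real_derivative r t * sin (\<sigma> 0 t)) (at t within {0..})" and
    \<sigma>': "\<And>t i. t \<ge> 0 \<Longrightarrow> i < CARD('n) \<Longrightarrow>
      (\<sigma> i has_real_derivative r t * \<sigma> (Suc i) t) (at t within {0..})"
    using admissible_chained_solution[OF adm zero_less_card_finite] by blast
  \<comment> \<open>The index shift is the one of \<open>coord_change\<close>. The remaining
    function \<open>\<sigma> CARD('n)\<close> is not a state; it enters through the input
    \<open>v\<close>.\<close>
  define s :: "real \<Rightarrow> real ^ 'n" where "s t = (\<chi> j. \<sigma> (inv_into {1..CARD('n)} e j - 1) t)" for t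
  have s: "s t $ e (Suc i) = \<sigma> i t" if "i < CARD('n)" for i t
    using that bij_betw_imp_inj_on[OF enum] by (simp add: s_def inv_into_f_f)
  have s_cont: "continuous_on {0..} s"
  proof -
    have "inv_into {1..CARD('n)} e j \<in> {1..CARD('n)}" for j
      using bij_betw_imp_surj_on[OF enum] by (intro inv_into_into) auto
    then have "inv_into {1..CARD('n)} e j - 1 \<le> CARD('n)" for j
      by (metis atLeastAtMost_iff diff_le_self le_trans)
    then show ?thesis
      unfolding s_def by (intro continuous_on_vec_lambda \<sigma>)
  qed
  \<comment> \<open>Since \<open>S\<close> maps onto the whole space, every value of
    \<open>s\<close> has a preimage in \<open>\<O>\<close>.\<close>
  define y where "y t = inv_into \<O> S (s t)" for t
  have y_in: "y t \<in> \<O>" and Sy: "S (y t) = s t" for t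
    using bij by (auto simp: y_def bij_betw_def inv_into_into f_inv_into_f)
  have "continuous_on UNIV (inv_into \<O> S)"
    by (rule continuous_on_inverse_of_manifold_bijection[OF chart O_sub(1) _ C1_S bij])
      (use chart_around in auto)
  then have y_cont: "continuous_on {0..} y"
    unfolding y_def using continuous_on_compose2[OF _ s_cont] by blast
  define v where "v t = r t * \<sigma> CARD('n) t" for t
  \<comment> \<open>The solution of the triangular system in which \<open>F (y t)\<close> sends
    \<open>u t\<close> to the chained input with components \<open>r t\<close> and
    \<open>v t\<close>.\<close>
  define u :: "real \<Rightarrow> real ^ 2" where
    "u t = vector [r t, (v t - \<phi> CARD('n) (y t) * r t) / \<gamma> (y t)]" for t
  have u: "u t $ 1 = r t" "u t $ 2 = (v t - \<phi> CARD('n) (y t) * r t) / \<gamma> (y t)" for t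
    by (simp_all add: u_def)
  have Fu: "(F (y t) *v u t) $ 1 = r t" "(F (y t) *v u t) $ 2 = v t" for t
    using lie_nonzero[OF y_in] by (simp_all add: F_apply u)
  have "continuous_on {0..} (\<lambda>t. \<phi> CARD('n) (y t))" "continuous_on {0..} (\<lambda>t. \<gamma> (y t))"
    by (rule continuous_on_compose2[OF _ y_cont], rule continuous_on_lie, use y_in in blast)+
  moreover have "continuous_on {0..} v"
    unfolding v_def by (intro continuous_on_mult r \<sigma>) simp
  ultimately have "continuous_on {0..} (\<lambda>t. (v t - \<phi> CARD('n) (y t) * r t) / \<gamma> (y t))"
    by (intro continuous_on_divide continuous_on_diff continuous_on_mult r) (use lie_nonzero y_in in auto)
  with r have "continuous_on {0..} (\<lambda>t. u t $ j)" for j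
    using exhaust_2[of j] u by (auto simp only:)
  then have u_cont: "continuous_on {0..} u"
    using continuous_on_vec_lambda[of "{0..}" "\<lambda>j t. u t $ j"] by simp
  have "solves_chained_system e {0..} x (\<lambda>t. S (y t)) (\<lambda>t. F (y t) *v u t)"
    unfolding solves_chained_system_def Fu Sy
  proof (intro ballI conjI)
    fix t :: real assume "t \<in> {0..}"
    then have t: "t \<ge> 0" by simp
    have s1: "s t $ e 1 = \<sigma> 0 t" for t using s[of 0] by simp
    show "((\<lambda>t. x t $ 1) has_real_derivative r t * cos (s t $ e 1)) (at t within {0..})"
      "((\<lambda>t. x t $ 2) has_real_derivative r t * sin (s t $ e 1)) (at t within {0..})"
      unfolding s1 by (rule x1[OF t] x2[OF t])+
    show "((\<lambda>t. s t $ e i) has_real_derivative r t * s t $ e (i + 1)) (at t within {0..})"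
      if i: "i \<in> {1..<CARD('n)}" for i
    proof -
      obtain j where "i = Suc j"
        using i by (cases i) auto
      then show ?thesis using i \<sigma>'[OF t, of j] s[of j] s[of "Suc j"] by simp
    qed
    obtain k where k: "CARD('n) = Suc k"
      using zero_less_card_finite[where 'a = 'n] gr0_implies_Suc by blast
    show "((\<lambda>t. s t $ e CARD('n)) has_real_derivative v t) (at t within {0..})"
      using \<sigma>'[OF t, of k] s[of k] by (simp add: k v_def)
  qed
  then have sol: "solves_system A y1 h1 h2 {0..} x y u"
    using solves_iff[OF y_cont] y_in by blast
  have "C1_curve_in A y {0..}"
    unfolding C1_curve_in_def
  proof (intro conjI ballI)
    show "y ` {0..} \<subseteq> \<Union> (fst ` A)" using y_in chart_around by blast
    fix c assume c: "c \<in> A"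
    let ?I = "{t \<in> {0..}. y t \<in> fst c}"
    \<comment> \<open>The system itself prescribes the chart velocity; it is continuous because the
      inputs, the curve and the components of the two fields are.\<close>
    let ?w = "\<lambda>t. u t $ 1 *\<^sub>R h1 c (y t) + u t $ 2 *\<^sub>R h2 c (y t)"
    have "continuous_on ?I (\<lambda>t. h c (y t))" if "Ck_vector_field A k h" for h k
    proof -
      have yI: "continuous_on ?I y" using y_cont by (rule continuous_on_subset) auto
      have yc: "continuous_on ?I (\<lambda>t. snd c (y t))"
        by (rule continuous_on_compose2[OF continuous_on_chart[OF chart[OF c]] yI]) auto
      have "continuous_on (snd c ` fst c) (h c \<circ> chart_inv c)"
        using Ck_on_imp_continuous_on[OF Ck_vector_field_imp_Ck_on[OF that c, of UNIV]] by simp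
      from continuous_on_compose2[OF this yc]
      have "continuous_on ?I (\<lambda>t. (h c \<circ> chart_inv c) (snd c (y t)))"
        by blast
      then show ?thesis
        by (rule continuous_on_cong[THEN iffD1, rotated -1]) (auto simp: chart_inv_left[OF chart[OF c]])
    qed
    from this[OF h1] this[OF h2] have "continuous_on ?I ?w"
      by (intro continuous_intros bounded_linear.continuous_on[OF bounded_linear_vec_nth]
          continuous_on_subset[OF u_cont]) auto
    moreover have "((snd c \<circ> y) has_vector_derivative ?w t) (at t within {0..})"
      if "t \<in> {0..}" "y t \<in> fst c" for t
      using sol that c by (auto simp: solves_system_def has_velocity_def)
    ultimately show "\<exists>w. continuous_on ?I w \<and>
        (\<forall>t\<in>{0..}. y t \<in> fst c \<longrightarrow> ((snd c \<circ> y) has_vector_derivative w t) (at t within {0..}))"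
      by (intro exI[of _ ?w]) blast
  qed (rule y_cont)
  moreover have "Ck_curve_on 1 x {0..}"
    using adm Ck_curve_on_mono[of "CARD('n) + 1" x "{0..}" 1] by (simp add: admissible_def del: Ck_curve_on.simps)
  ultimately show "\<exists>yD uD. Ck_curve_on 1 x {0..} \<and> C1_curve_in A yD {0..} \<and>
      (\<forall>t\<ge>0. (x t, yD t) \<in> UNIV \<times> \<O>) \<and> continuous_on {0..} uD \<and>
      solves_system A y1 h1 h2 {0..} x yD uD"
    using y_in u_cont sol by blast
qed

end

theorem theorem1:
  fixes \<Y> \<O> :: "'m::{t2_space, second_countable_topology} set"
    and A :: "('m, 'n::finite) chart set"
    and e :: "nat \<Rightarrow> 'n"
    and y1 :: "'m \<Rightarrow> real"
    and z :: "'m \<Rightarrow> 'q::topological_space"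
    and Q :: "'q set"
    and h1 h2 :: "('m, 'n) vfield"
  assumes enum: "bij_betw e {1..CARD('n)} UNIV"
    and manifold: "smooth_manifold \<Y> A"
    and h1: "Ck_vector_field A (CARD('n) - 1) h1"
    and h2: "Ck_vector_field A (CARD('n) - 1) h2"
    and O_sub: "open \<O>" "\<O> \<subseteq> \<Y>"
    and split: "splits_as_line_times A \<O> (e 1) y1 z Q"
    and lie_zero: "\<And>p i. p \<in> \<O> \<Longrightarrow> i + 2 \<le> CARD('n) \<Longrightarrow>
          lie_derivative A h2 ((lie_derivative A h1 ^^ i) y1) p = 0"
    and lie_nonzero: "\<And>p. p \<in> \<O> \<Longrightarrow>
          lie_derivative A h2 ((lie_derivative A h1 ^^ (CARD('n) - 1)) y1) p \<noteq> 0"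
  shows
    "Ck_on_manifold A 1 (coord_change A e y1 h1) \<O> \<and>
     nonsingular_jacobian_on A (coord_change A e y1 h1) \<O> \<and>
     continuous_on \<O> (feedback_matrix A y1 h1 h2) \<and>
     (\<forall>p\<in>\<O>. invertible (feedback_matrix A y1 h1 h2 p)) \<and>
     (\<forall>I x y u. is_interval I \<longrightarrow> interior I \<noteq> {} \<longrightarrow> continuous_on I y \<longrightarrow> y ` I \<subseteq> \<O> \<longrightarrow>
        (solves_system A y1 h1 h2 I x y u \<longleftrightarrow>
         solves_chained_system e I x (\<lambda>t. coord_change A e y1 h1 (y t))
           (\<lambda>t. feedback_matrix A y1 h1 h2 (y t) *v u t))) \<and>
     (bij_betw (coord_change A e y1 h1) \<O> UNIV \<longrightarrow>
        maneuverable A y1 h1 h2 (UNIV \<times> \<O>))"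
proof -
  interpret lie_chain \<Y> \<O> A e y1 h1 h2
    by (rule lie_chain.intro[OF enum manifold h1 h2 O_sub
          split_coordinate_smooth[OF manifold O_sub(1) split] lie_zero lie_nonzero])
  show ?thesis
  proof (intro conjI allI impI ballI)
    show "Ck_on_manifold A 1 S \<O>" by (rule C1_S)
    show "nonsingular_jacobian_on A S \<O>" by (rule nonsingular_S)
    show "continuous_on \<O> F" by (rule continuous_on_F)
    show "invertible (F p)" if "p \<in> \<O>" for p by (rule invertible_F[OF that])
    show "solves_system A y1 h1 h2 I x y u \<longleftrightarrow>
        solves_chained_system e I x (\<lambda>t. S (y t)) (\<lambda>t. F (y t) *v u t)"
      if "continuous_on I y" "y ` I \<subseteq> \<O>" for I x y u
      by (rule solves_iff[OF that])
    show "maneuverable A y1 h1 h2 (UNIV \<times> \<O>)" if "bij_betw S \<O> UNIV"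
      by (rule maneuverable_if_bij[OF that])
  qed
qed

end
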